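(* Let $R$ be a commutative ring with unit and let $X$ be a connected smooth manifold. Let $\mathcal{M}^*$ and $\mathcal{N}^*$ be either both M-V systems of cdp presheaves of $R$-modules on $X$, or both M-V systems of cds precosheaves of $R$-modules on $X$. Assume that $F^*:\mathcal{M}^*\rightarrow\mathcal{N}^*$ is an M-V morphism satisfying the following hypothesis: ( * ) There exists a basis $\mathfrak{U}$ of the topology of $X$ such that $F^*(U_1\cap\dots\cap U_l)$ is an isomorphism for any finitely many $U_1,\dots,U_l\in\mathfrak{U}$. Then $F^*$ is an isomorphism.
   Context: All presheaves, precosheaves and their morphisms are of $R$-modules. For a presheaf (resp. precosheaf) $\mathcal{M}$ on a topological space $X$ and open sets $V\subseteq U$, write $\rho_{U,V}:\mathcal{M}(U)\to\mathcal{M}(V)$ for the restriction (resp. $i_{V,U}:\mathcal{M}(V)\to\mathcal{M}(U)$ for the extension); a precosheaf is a covariant functor on open sets. $\mathcal{M}$ is a cdp presheaf (resp. cds precosheaf) if for any collection $\{U_n\mid n\in\mathbb{N}^+\}$ of disjoint open subsets of $X$ the map $(\rho_{\bigcup_n U_n,U_n})_{n}:\mathcal{M}(\bigcup_{n=1}^\infty U_n)\to\prod_{n=1}^\infty\mathcal{M}(U_n)$ (resp. $\sum_n i_{U_n,\bigcup_n U_n}:\bigoplus_{n=1}^\infty\mathcal{M}(U_n)\to\mathcal{M}(\bigcup_{n=1}^\infty U_n)$) is an isomorphism. An M-V system of presheaves on $X$ is a collection $\mathcal{M}^*=\{(\mathcal{M}^p,\delta^p)\mid p\in\mathbb{Z}\}$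 where each $\mathcal{M}^p$ is a presheaf on $X$ and, for any open subsets $U,V$ and all $p$, $\delta^p_{U,V}:\mathcal{M}^p(U\cap V)\to\mathcal{M}^{p+1}(U\cup V)$ is a morphism such that the sequence $$\cdots\to\mathcal{M}^{p-1}(U\cap V)\xrightarrow{\delta^{p-1}_{U,V}}\mathcal{M}^p(U\cup V)\xrightarrow{P^p_{U,V}}\mathcal{M}^p(U)\oplus\mathcal{M}^p(V)\xrightarrow{Q^p_{U,V}}\mathcal{M}^p(U\cap V)\xrightarrow{\delta^p_{U,V}}\mathcal{M}^{p+1}(U\cup V)\to\cdots$$ is exact, where $P^p_{U,V}(\alpha)=(\rho^p_{U\cup V,U}(\alpha),\rho^p_{U\cup V,V}(\alpha))$ and $Q^p_{U,V}(\beta,\gamma)=\rho^p_{U,U\cap V}(\beta)-\rho^p_{V,U\cap V}(\gamma)$. An M-V system of precosheaves is a collection $\mathcal{M}^*=\{(\mathcal{M}^p,\delta^p)\mid p\in\mathbb{Z}\}$ where each $\mathcal{M}^p$ is a precosheaf and, for any open $U,V$ and all $p$, $\delta^p_{U,V}:\mathcal{M}^p(U\cup V)\to\mathcal{M}^{p+1}(U\cap V)$ is a morphism such that $$\cdots\to\mathcal{M}^{p-1}(U\cup V)\xrightarrow{\delta^{p-1}_{U,V}}\mathcal{M}^p(U\cap V)\xrightarrow{P^p_{U,V}}\mathcal{M}^p(U)\oplus\mathcal{M}^p(V)\xrightarrow{Q^p_{U,V}}\mathcal{M}^p(U\cup V)\xrightarrow{\delta^p_{U,V}}\mathcal{M}^{p+1}(U\cap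 V)\to\cdots$$ is exact, where $P^p_{U,V}(\alpha)=(i^p_{U\cap V,U}(\alpha),i^p_{U\cap V,V}(\alpha))$ and $Q^p_{U,V}(\beta,\gamma)=i^p_{U,U\cup V}(\beta)-i^p_{V,U\cup V}(\gamma)$. An M-V system of cdp presheaves (cds precosheaves) is an M-V system in which every $\mathcal{M}^p$ is a cdp presheaf (cds precosheaf). An M-V morphism $F^*:\mathcal{M}^*\to\mathcal{N}^*$ is a collection $\{F^p:\mathcal{M}^p\to\mathcal{N}^p\mid p\in\mathbb{Z}\}$ of morphisms of presheaves (resp. precosheaves) such that, for all open $U,V$, the maps $F^p$ on $U\cap V$, $U\cup V$, and $(F^p(U),F^p(V))$ on the direct sums, form a commutative ladder from the long exact sequence $$\cdots\to\mathcal{M}^p(U\cup V)\xrightarrow{P^p_{U,V}}\mathcal{M}^p(U)\oplus\mathcal{M}^p(V)\xrightarrow{Q^p_{U,V}}\mathcal{M}^p(U\cap V)\xrightarrow{\delta^p_{U,V}}\mathcal{M}^{p+1}(U\cup V)\to\cdots$$ (resp. $$\cdots\to\mathcal{M}^p(U\cap V)\xrightarrow{P^p_{U,V}}\mathcal{M}^p(U)\oplus\mathcal{M}^p(V)\xrightarrow{Q^p_{U,V}}\mathcal{M}^p(U\cup V)\xrightarrow{\delta^p_{U,V}}\mathcal{M}^{p+1}(U\cap V)\to\cdots)$$ to the long exact sequence $$\cdots\to\mathcal{N}^p(U\cup V)\xrightarrow{P^p_{U,V}}\mathcal{N}^p(U)\oplus\mathcal{N}^p(V)\xrightarrow{Q^p_{U,V}}\mathcal{N}^p(U\cap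 V)\xrightarrow{\delta^p_{U,V}}\mathcal{N}^{p+1}(U\cup V)\to\cdots$$ (resp. $$\cdots\to\mathcal{N}^p(U\cap V)\xrightarrow{P^p_{U,V}}\mathcal{N}^p(U)\oplus\mathcal{N}^p(V)\xrightarrow{Q^p_{U,V}}\mathcal{N}^p(U\cup V)\xrightarrow{\delta^p_{U,V}}\mathcal{N}^{p+1}(U\cap V)\to\cdots)$$ (including the squares involving $\delta$, i.e. $F^{p+1}(U\cup V)\circ\delta^p_{U,V}=\delta^p_{U,V}\circ F^p(U\cap V)$, resp. $F^{p+1}(U\cap V)\circ\delta^p_{U,V}=\delta^p_{U,V}\circ F^p(U\cup V)$, for all $p$). For an open set $U$, $F^*(U)$ is called an isomorphism if $F^p(U):\mathcal{M}^p(U)\to\mathcal{N}^p(U)$ is an isomorphism for all $p$. $F^*$ is called an isomorphism if $F^*(U)$ is an isomorphism for every open $U\subseteq X$. *)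

theory Defs
  imports "HOL-Analysis.Analysis" "HOL-Algebra.Module" "HOL-Algebra.AbelCoset"
begin

section \<open>Smooth manifolds\<close>

text \<open>
  \<open>Ck_on n k S f\<close>: the real function \<open>f\<close> is of class \<open>C\<^sup>k\<close> on \<open>S\<close>, an open subset of
  \<open>Euclidean_space n\<close> (the sequences vanishing from index \<open>n\<close> on). Since \<open>S\<close> is open, the
  partial derivatives at points of \<open>S\<close> depend only on the values of \<open>f\<close> on \<open>S\<close>.
\<close>

primrec Ck_on :: "nat \<Rightarrow> nat \<Rightarrow> (nat \<Rightarrow> real) set \<Rightarrow> ((nat \<Rightarrow> real) \<Rightarrow> real) \<Rightarrow> bool" where
  "Ck_on n 0 S f \<longleftrightarrow> continuous_map (subtopology (Euclidean_space n) S) euclideanreal f"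
| "Ck_on n (Suc k) S f \<longleftrightarrow>
     continuous_map (subtopology (Euclidean_space n) S) euclideanreal f \<and>
     (\<forall>i<n. \<exists>g. (\<forall>x\<in>S. ((\<lambda>t. f (x(i := t))) has_real_derivative g x) (at (x i))) \<and> Ck_on n k S g)"

definition smooth_map_on ::
    "nat \<Rightarrow> nat \<Rightarrow> (nat \<Rightarrow> real) set \<Rightarrow> ((nat \<Rightarrow> real) \<Rightarrow> (nat \<Rightarrow> real)) \<Rightarrow> bool" where
  "smooth_map_on n m S f \<longleftrightarrow> (\<forall>j<m. \<forall>k. Ck_on n k S (\<lambda>x. f x j))"

definition chart :: "nat \<Rightarrow> 'x topology \<Rightarrow> 'x set \<Rightarrow> ('x \<Rightarrow> nat \<Rightarrow> real) \<Rightarrow> bool" where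
  "chart n X U \<phi> \<longleftrightarrow>
     openin X U \<and> openin (Euclidean_space n) (\<phi> ` U) \<and>
     homeomorphic_map (subtopology X U) (subtopology (Euclidean_space n) (\<phi> ` U)) \<phi>"

text \<open>
  The smooth structure is given by any smooth atlas \<open>\<A>\<close>; it need not be maximal. Manifolds are
  Hausdorff and second countable.
\<close>

definition smooth_manifold ::
    "nat \<Rightarrow> 'x topology \<Rightarrow> ('x set \<times> ('x \<Rightarrow> nat \<Rightarrow> real)) set \<Rightarrow> bool" where
  "smooth_manifold n X \<A> \<longleftrightarrow>
     Hausdorff_space X \<and> second_countable X \<and>
     (\<forall>(U, \<phi>)\<in>\<A>. chart n X U \<phi>) \<and>
     (\<Union>(U, \<phi>)\<in>\<A>. U) = topspace X \<and>
     (\<forall>(U, \<phi>)\<in>\<A>. \<forall>(V, \<psi>)\<in>\<A>. smooth_map_on n n (\<phi> ` (U \<inter> V)) (\<psi> \<circ> inv_into U \<phi>))"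

definition topology_basis :: "'x topology \<Rightarrow> 'x set set \<Rightarrow> bool" where
  "topology_basis X \<B> \<longleftrightarrow> openin X = arbitrary union_of (\<lambda>U. U \<in> \<B>)"


section \<open>Modules\<close>

definition mod_hom ::
    "('r, 's) ring_scheme \<Rightarrow> ('r, 'm) module \<Rightarrow> ('r, 'n) module \<Rightarrow> ('m \<Rightarrow> 'n) set" where
  "mod_hom R M N =
     {h \<in> carrier M \<rightarrow> carrier N.
        (\<forall>x\<in>carrier M. \<forall>y\<in>carrier M. h (x \<oplus>\<^bsub>M\<^esub> y) = h x \<oplus>\<^bsub>N\<^esub> h y) \<and>
        (\<forall>a\<in>carrier R. \<forall>x\<in>carrier M. h (a \<odot>\<^bsub>M\<^esub> x) = a \<odot>\<^bsub>N\<^esub> h x)}"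

definition mod_iso ::
    "('r, 's) ring_scheme \<Rightarrow> ('r, 'm) module \<Rightarrow> ('r, 'n) module \<Rightarrow> ('m \<Rightarrow> 'n) set" where
  "mod_iso R M N = {h \<in> mod_hom R M N. bij_betw h (carrier M) (carrier N)}"

text \<open>
  The record type of modules extends that of rings; the fields \<open>mult\<close> and \<open>one\<close> play no role
  for modules and are left undefined in the constructions below.
\<close>

definition mod_sum2 :: "('r, 'm) module \<Rightarrow> ('r, 'n) module \<Rightarrow> ('r, 'm \<times> 'n) module" where
  "mod_sum2 M N =
     \<lparr>carrier = carrier M \<times> carrier N,
      monoid.mult = undefined, one = undefined,
      zero = (\<zero>\<^bsub>M\<^esub>, \<zero>\<^bsub>N\<^esub>),
      add = (\<lambda>x y. (fst x \<oplus>\<^bsub>M\<^esub> fst y, snd x \<oplus>\<^bsub>N\<^esub> snd y)),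
      smult = (\<lambda>a x. (a \<odot>\<^bsub>M\<^esub> fst x, a \<odot>\<^bsub>N\<^esub> snd x))\<rparr>"

definition mod_prod :: "'i set \<Rightarrow> ('i \<Rightarrow> ('r, 'm) module) \<Rightarrow> ('r, 'i \<Rightarrow> 'm) module" where
  "mod_prod I M =
     \<lparr>carrier = (\<Pi>\<^sub>E i\<in>I. carrier (M i)),
      monoid.mult = undefined, one = undefined,
      zero = (\<lambda>i\<in>I. \<zero>\<^bsub>M i\<^esub>),
      add = (\<lambda>x y. \<lambda>i\<in>I. x i \<oplus>\<^bsub>M i\<^esub> y i),
      smult = (\<lambda>a x. \<lambda>i\<in>I. a \<odot>\<^bsub>M i\<^esub> x i)\<rparr>"

definition mod_dsum :: "'i set \<Rightarrow> ('i \<Rightarrow> ('r, 'm) module) \<Rightarrow> ('r, 'i \<Rightarrow> 'm) module" where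
  "mod_dsum I M =
     (mod_prod I M)\<lparr>carrier := {x \<in> \<Pi>\<^sub>E i\<in>I. carrier (M i). finite {i \<in> I. x i \<noteq> \<zero>\<^bsub>M i\<^esub>}}\<rparr>"

text \<open>The map from the direct sum of the \<open>M i\<close> to \<open>N\<close> induced by maps \<open>f i\<close> from \<open>M i\<close> to \<open>N\<close>.\<close>

definition mod_sum_map ::
    "'i set \<Rightarrow> ('i \<Rightarrow> ('r, 'm) module) \<Rightarrow> ('r, 'n) module \<Rightarrow> ('i \<Rightarrow> 'm \<Rightarrow> 'n) \<Rightarrow> ('i \<Rightarrow> 'm) \<Rightarrow> 'n" where
  "mod_sum_map I M N f x = (\<Oplus>\<^bsub>N\<^esub>i \<in> {i \<in> I. x i \<noteq> \<zero>\<^bsub>M i\<^esub>}. f i (x i))"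

definition mod_exact ::
    "('r, 'a) module \<Rightarrow> ('a \<Rightarrow> 'b) \<Rightarrow> ('r, 'b) module \<Rightarrow> ('b \<Rightarrow> 'c) \<Rightarrow> ('r, 'c) module \<Rightarrow> bool" where
  "mod_exact A f B g C \<longleftrightarrow> f ` carrier A = a_kernel B C g"


section \<open>Presheaves and precosheaves\<close>

text \<open>
  Maps indexed by two open sets carry the source first: for a presheaf \<open>r U V\<close> is the
  restriction from \<open>M U\<close> to \<open>M V\<close> (where \<open>V \<subseteq> U\<close>), for a precosheaf \<open>e V U\<close> is the extension
  from \<open>M V\<close> to \<open>M U\<close>.
\<close>

definition presheaf ::
    "('r, 's) ring_scheme \<Rightarrow> 'x topology \<Rightarrow> ('x set \<Rightarrow> ('r, 'm) module) \<Rightarrow>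
     ('x set \<Rightarrow> 'x set \<Rightarrow> 'm \<Rightarrow> 'm) \<Rightarrow> bool" where
  "presheaf R X M r \<longleftrightarrow>
     (\<forall>U. openin X U \<longrightarrow> Module.module R (M U)) \<and>
     (\<forall>U V. openin X U \<longrightarrow> openin X V \<longrightarrow> V \<subseteq> U \<longrightarrow> r U V \<in> mod_hom R (M U) (M V)) \<and>
     (\<forall>U. openin X U \<longrightarrow> (\<forall>x\<in>carrier (M U). r U U x = x)) \<and>
     (\<forall>U V W. openin X U \<longrightarrow> openin X V \<longrightarrow> openin X W \<longrightarrow> W \<subseteq> V \<longrightarrow> V \<subseteq> U \<longrightarrow>
        (\<forall>x\<in>carrier (M U). r V W (r U V x) = r U W x))"

definition precosheaf ::
    "('r, 's) ring_scheme \<Rightarrow> 'x topology \<Rightarrow> ('x set \<Rightarrow> ('r, 'm) module) \<Rightarrow>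
     ('x set \<Rightarrow> 'x set \<Rightarrow> 'm \<Rightarrow> 'm) \<Rightarrow> bool" where
  "precosheaf R X M e \<longleftrightarrow>
     (\<forall>U. openin X U \<longrightarrow> Module.module R (M U)) \<and>
     (\<forall>U V. openin X U \<longrightarrow> openin X V \<longrightarrow> V \<subseteq> U \<longrightarrow> e V U \<in> mod_hom R (M V) (M U)) \<and>
     (\<forall>U. openin X U \<longrightarrow> (\<forall>x\<in>carrier (M U). e U U x = x)) \<and>
     (\<forall>U V W. openin X U \<longrightarrow> openin X V \<longrightarrow> openin X W \<longrightarrow> W \<subseteq> V \<longrightarrow> V \<subseteq> U \<longrightarrow>
        (\<forall>x\<in>carrier (M W). e V U (e W V x) = e W U x))"

definition presheaf_morphism ::
    "('r, 's) ring_scheme \<Rightarrow> 'x topology \<Rightarrow>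
     ('x set \<Rightarrow> ('r, 'm) module) \<Rightarrow> ('x set \<Rightarrow> 'x set \<Rightarrow> 'm \<Rightarrow> 'm) \<Rightarrow>
     ('x set \<Rightarrow> ('r, 'n) module) \<Rightarrow> ('x set \<Rightarrow> 'x set \<Rightarrow> 'n \<Rightarrow> 'n) \<Rightarrow>
     ('x set \<Rightarrow> 'm \<Rightarrow> 'n) \<Rightarrow> bool" where
  "presheaf_morphism R X M r N s f \<longleftrightarrow>
     (\<forall>U. openin X U \<longrightarrow> f U \<in> mod_hom R (M U) (N U)) \<and>
     (\<forall>U V. openin X U \<longrightarrow> openin X V \<longrightarrow> V \<subseteq> U \<longrightarrow>
        (\<forall>x\<in>carrier (M U). f V (r U V x) = s U V (f U x)))"

definition precosheaf_morphism ::
    "('r, 's) ring_scheme \<Rightarrow> 'x topology \<Rightarrow>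
     ('x set \<Rightarrow> ('r, 'm) module) \<Rightarrow> ('x set \<Rightarrow> 'x set \<Rightarrow> 'm \<Rightarrow> 'm) \<Rightarrow>
     ('x set \<Rightarrow> ('r, 'n) module) \<Rightarrow> ('x set \<Rightarrow> 'x set \<Rightarrow> 'n \<Rightarrow> 'n) \<Rightarrow>
     ('x set \<Rightarrow> 'm \<Rightarrow> 'n) \<Rightarrow> bool" where
  "precosheaf_morphism R X M e N d f \<longleftrightarrow>
     (\<forall>U. openin X U \<longrightarrow> f U \<in> mod_hom R (M U) (N U)) \<and>
     (\<forall>U V. openin X U \<longrightarrow> openin X V \<longrightarrow> V \<subseteq> U \<longrightarrow>
        (\<forall>x\<in>carrier (M V). f U (e V U x) = d V U (f V x)))"

definition cdp_presheaf ::
    "('r, 's) ring_scheme \<Rightarrow> 'x topology \<Rightarrow> ('x set \<Rightarrow> ('r, 'm) module) \<Rightarrow>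
     ('x set \<Rightarrow> 'x set \<Rightarrow> 'm \<Rightarrow> 'm) \<Rightarrow> bool" where
  "cdp_presheaf R X M r \<longleftrightarrow>
     presheaf R X M r \<and>
     (\<forall>U :: nat \<Rightarrow> 'x set. (\<forall>n\<ge>1. openin X (U n)) \<longrightarrow> disjoint_family_on U {1..} \<longrightarrow>
        (\<lambda>x. \<lambda>n\<in>{1..}. r (\<Union>n\<in>{1..}. U n) (U n) x)
          \<in> mod_iso R (M (\<Union>n\<in>{1..}. U n)) (mod_prod {1..} (\<lambda>n. M (U n))))"

definition cds_precosheaf ::
    "('r, 's) ring_scheme \<Rightarrow> 'x topology \<Rightarrow> ('x set \<Rightarrow> ('r, 'm) module) \<Rightarrow>
     ('x set \<Rightarrow> 'x set \<Rightarrow> 'm \<Rightarrow> 'm) \<Rightarrow> bool" where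
  "cds_precosheaf R X M e \<longleftrightarrow>
     precosheaf R X M e \<and>
     (\<forall>U :: nat \<Rightarrow> 'x set. (\<forall>n\<ge>1. openin X (U n)) \<longrightarrow> disjoint_family_on U {1..} \<longrightarrow>
        mod_sum_map {1..} (\<lambda>n. M (U n)) (M (\<Union>n\<in>{1..}. U n)) (\<lambda>n. e (U n) (\<Union>n\<in>{1..}. U n))
          \<in> mod_iso R (mod_dsum {1..} (\<lambda>n. M (U n))) (M (\<Union>n\<in>{1..}. U n)))"


section \<open>Mayer-Vietoris systems\<close>

text \<open>
  Data common to both kinds of systems: the modules \<open>obj M p U\<close>, the restriction or extension
  maps \<open>arr M p\<close> (source first, as above) and the connecting maps \<open>conn M p U V\<close>.
\<close>

record ('x, 'r, 'm) mv_data =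
  obj :: "int \<Rightarrow> 'x set \<Rightarrow> ('r, 'm) module"
  arr :: "int \<Rightarrow> 'x set \<Rightarrow> 'x set \<Rightarrow> 'm \<Rightarrow> 'm"
  conn :: "int \<Rightarrow> 'x set \<Rightarrow> 'x set \<Rightarrow> 'm \<Rightarrow> 'm"

definition presheaf_P :: "('x, 'r, 'm) mv_data \<Rightarrow> int \<Rightarrow> 'x set \<Rightarrow> 'x set \<Rightarrow> 'm \<Rightarrow> 'm \<times> 'm" where
  "presheaf_P M p U V \<alpha> = (arr M p (U \<union> V) U \<alpha>, arr M p (U \<union> V) V \<alpha>)"

definition presheaf_Q :: "('x, 'r, 'm) mv_data \<Rightarrow> int \<Rightarrow> 'x set \<Rightarrow> 'x set \<Rightarrow> 'm \<times> 'm \<Rightarrow> 'm" where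
  "presheaf_Q M p U V = (\<lambda>(\<beta>, \<gamma>).
     arr M p U (U \<inter> V) \<beta> \<ominus>\<^bsub>obj M p (U \<inter> V)\<^esub> arr M p V (U \<inter> V) \<gamma>)"

definition precosheaf_P :: "('x, 'r, 'm) mv_data \<Rightarrow> int \<Rightarrow> 'x set \<Rightarrow> 'x set \<Rightarrow> 'm \<Rightarrow> 'm \<times> 'm" where
  "precosheaf_P M p U V \<alpha> = (arr M p (U \<inter> V) U \<alpha>, arr M p (U \<inter> V) V \<alpha>)"

definition precosheaf_Q :: "('x, 'r, 'm) mv_data \<Rightarrow> int \<Rightarrow> 'x set \<Rightarrow> 'x set \<Rightarrow> 'm \<times> 'm \<Rightarrow> 'm" where
  "precosheaf_Q M p U V = (\<lambda>(\<beta>, \<gamma>).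
     arr M p U (U \<union> V) \<beta> \<ominus>\<^bsub>obj M p (U \<union> V)\<^esub> arr M p V (U \<union> V) \<gamma>)"

definition mv_system_presheaves ::
    "('r, 's) ring_scheme \<Rightarrow> 'x topology \<Rightarrow> ('x, 'r, 'm) mv_data \<Rightarrow> bool" where
  "mv_system_presheaves R X M \<longleftrightarrow>
     (\<forall>p. presheaf R X (obj M p) (arr M p)) \<and>
     (\<forall>p U V. openin X U \<longrightarrow> openin X V \<longrightarrow>
        conn M p U V \<in> mod_hom R (obj M p (U \<inter> V)) (obj M (p + 1) (U \<union> V)) \<and>
        mod_exact (obj M (p - 1) (U \<inter> V)) (conn M (p - 1) U V)
          (obj M p (U \<union> V)) (presheaf_P M p U V) (mod_sum2 (obj M p U) (obj M p V)) \<and>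
        mod_exact (obj M p (U \<union> V)) (presheaf_P M p U V)
          (mod_sum2 (obj M p U) (obj M p V)) (presheaf_Q M p U V) (obj M p (U \<inter> V)) \<and>
        mod_exact (mod_sum2 (obj M p U) (obj M p V)) (presheaf_Q M p U V)
          (obj M p (U \<inter> V)) (conn M p U V) (obj M (p + 1) (U \<union> V)))"

definition mv_system_precosheaves ::
    "('r, 's) ring_scheme \<Rightarrow> 'x topology \<Rightarrow> ('x, 'r, 'm) mv_data \<Rightarrow> bool" where
  "mv_system_precosheaves R X M \<longleftrightarrow>
     (\<forall>p. precosheaf R X (obj M p) (arr M p)) \<and>
     (\<forall>p U V. openin X U \<longrightarrow> openin X V \<longrightarrow>
        conn M p U V \<in> mod_hom R (obj M p (U \<union> V)) (obj M (p + 1) (U \<inter> V)) \<and>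
        mod_exact (obj M (p - 1) (U \<union> V)) (conn M (p - 1) U V)
          (obj M p (U \<inter> V)) (precosheaf_P M p U V) (mod_sum2 (obj M p U) (obj M p V)) \<and>
        mod_exact (obj M p (U \<inter> V)) (precosheaf_P M p U V)
          (mod_sum2 (obj M p U) (obj M p V)) (precosheaf_Q M p U V) (obj M p (U \<union> V)) \<and>
        mod_exact (mod_sum2 (obj M p U) (obj M p V)) (precosheaf_Q M p U V)
          (obj M p (U \<union> V)) (conn M p U V) (obj M (p + 1) (U \<inter> V)))"

definition mv_system_cdp_presheaves ::
    "('r, 's) ring_scheme \<Rightarrow> 'x topology \<Rightarrow> ('x, 'r, 'm) mv_data \<Rightarrow> bool" where
  "mv_system_cdp_presheaves R X M \<longleftrightarrow>
     mv_system_presheaves R X M \<and> (\<forall>p. cdp_presheaf R X (obj M p) (arr M p))"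

definition mv_system_cds_precosheaves ::
    "('r, 's) ring_scheme \<Rightarrow> 'x topology \<Rightarrow> ('x, 'r, 'm) mv_data \<Rightarrow> bool" where
  "mv_system_cds_precosheaves R X M \<longleftrightarrow>
     mv_system_precosheaves R X M \<and> (\<forall>p. cds_precosheaf R X (obj M p) (arr M p))"

definition mv_morphism_presheaves ::
    "('r, 's) ring_scheme \<Rightarrow> 'x topology \<Rightarrow> ('x, 'r, 'm) mv_data \<Rightarrow> ('x, 'r, 'n) mv_data \<Rightarrow>
     (int \<Rightarrow> 'x set \<Rightarrow> 'm \<Rightarrow> 'n) \<Rightarrow> bool" where
  "mv_morphism_presheaves R X M N F \<longleftrightarrow>
     (\<forall>p. presheaf_morphism R X (obj M p) (arr M p) (obj N p) (arr N p) (F p)) \<and>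
     (\<forall>p U V. openin X U \<longrightarrow> openin X V \<longrightarrow>
        (\<forall>\<alpha>\<in>carrier (obj M p (U \<union> V)).
           map_prod (F p U) (F p V) (presheaf_P M p U V \<alpha>) = presheaf_P N p U V (F p (U \<union> V) \<alpha>)) \<and>
        (\<forall>\<beta>\<in>carrier (mod_sum2 (obj M p U) (obj M p V)).
           F p (U \<inter> V) (presheaf_Q M p U V \<beta>) = presheaf_Q N p U V (map_prod (F p U) (F p V) \<beta>)) \<and>
        (\<forall>\<gamma>\<in>carrier (obj M p (U \<inter> V)).
           F (p + 1) (U \<union> V) (conn M p U V \<gamma>) = conn N p U V (F p (U \<inter> V) \<gamma>)))"

definition mv_morphism_precosheaves ::
    "('r, 's) ring_scheme \<Rightarrow> 'x topology \<Rightarrow> ('x, 'r, 'm) mv_data \<Rightarrow> ('x, 'r, 'n) mv_data \<Rightarrow>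
     (int \<Rightarrow> 'x set \<Rightarrow> 'm \<Rightarrow> 'n) \<Rightarrow> bool" where
  "mv_morphism_precosheaves R X M N F \<longleftrightarrow>
     (\<forall>p. precosheaf_morphism R X (obj M p) (arr M p) (obj N p) (arr N p) (F p)) \<and>
     (\<forall>p U V. openin X U \<longrightarrow> openin X V \<longrightarrow>
        (\<forall>\<alpha>\<in>carrier (obj M p (U \<inter> V)).
           map_prod (F p U) (F p V) (precosheaf_P M p U V \<alpha>) = precosheaf_P N p U V (F p (U \<inter> V) \<alpha>)) \<and>
        (\<forall>\<beta>\<in>carrier (mod_sum2 (obj M p U) (obj M p V)).
           F p (U \<union> V) (precosheaf_Q M p U V \<beta>) = precosheaf_Q N p U V (map_prod (F p U) (F p V) \<beta>)) \<and>
        (\<forall>\<gamma>\<in>carrier (obj M p (U \<union> V)).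
           F (p + 1) (U \<inter> V) (conn M p U V \<gamma>) = conn N p U V (F p (U \<union> V) \<gamma>)))"

definition mv_iso_at ::
    "('r, 's) ring_scheme \<Rightarrow> ('x, 'r, 'm) mv_data \<Rightarrow> ('x, 'r, 'n) mv_data \<Rightarrow>
     (int \<Rightarrow> 'x set \<Rightarrow> 'm \<Rightarrow> 'n) \<Rightarrow> 'x set \<Rightarrow> bool" where
  "mv_iso_at R M N F U \<longleftrightarrow> (\<forall>p. F p U \<in> mod_iso R (obj M p U) (obj N p U))"

definition mv_iso ::
    "('r, 's) ring_scheme \<Rightarrow> 'x topology \<Rightarrow> ('x, 'r, 'm) mv_data \<Rightarrow> ('x, 'r, 'n) mv_data \<Rightarrow>
     (int \<Rightarrow> 'x set \<Rightarrow> 'm \<Rightarrow> 'n) \<Rightarrow> bool" where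
  "mv_iso R X M N F \<longleftrightarrow> (\<forall>U. openin X U \<longrightarrow> mv_iso_at R M N F U)"

end

theory Submission
  imports Defs
begin

text \<open>
  The class of open sets on which \<open>F\<close> is an isomorphism contains the empty set (the cdp or cds
  condition for \<open>U\<^sub>n = \<emptyset>\<close> forces the modules over \<open>\<emptyset>\<close> to vanish), contains \<open>U \<union> V\<close> with
  \<open>U\<close>, \<open>V\<close> and \<open>U \<inter> V\<close> (five lemma), and is closed under countable disjoint unions. Induction on
  the number of sets then gives all finite unions of basis sets. An arbitrary open set is
  exhausted by compact layers \<open>A\<^sub>n\<close>, each covered by a finite union \<open>W\<^sub>n\<close> of basis sets such that
  \<open>W\<^sub>n \<inter> W\<^sub>m = \<emptyset>\<close> whenever \<open>\<bar>n - m\<bar> \<ge> 2\<close>. The unions of the \<open>W\<^sub>n\<close> with even and with odd index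
  are disjoint unions, and so is their intersection \<open>\<Union>n. W\<^sub>n \<inter> W\<^sub>n\<^sub>+\<^sub>1\<close>, so one more
  Mayer-Vietoris step finishes the proof.
\<close>

section \<open>Induction on open sets\<close>

lemma locally_compact_space_manifold:
  assumes "smooth_manifold n X \<A>"
  shows "locally_compact_space X"
  unfolding locally_compact_space_def
proof
  fix x assume "x \<in> topspace X"
  then obtain U \<phi> where "(U, \<phi>) \<in> \<A>" and x: "x \<in> U"
    using assms unfolding smooth_manifold_def by blast
  then have ch: "chart n X U \<phi>"
    using assms unfolding smooth_manifold_def by blast
  \<comment> \<open>Open subsets of Euclidean space are locally compact, and the chart carries this
    over to \<open>U\<close>. Since \<open>U\<close> is open in \<open>X\<close>, a compact
    neighbourhood inside \<open>U\<close> is also one in \<open>X\<close>.\<close>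
  have "locally_compact_space (subtopology (Euclidean_space n) (\<phi> ` U))"
    using ch unfolding chart_def
    by (intro locally_compact_space_open_subset)
      (auto simp: Hausdorff_Euclidean_space locally_compact_Euclidean_space)
  then have "locally_compact_space (subtopology X U)"
    using ch unfolding chart_def
    by (meson homeomorphic_locally_compact_space homeomorphic_map_imp_homeomorphic_space)
  moreover have "x \<in> topspace (subtopology X U)"
    using \<open>x \<in> topspace X\<close> x by simp
  ultimately obtain V K where "openin (subtopology X U) V" "compactin (subtopology X U) K" "x \<in> V" "V \<subseteq> K"
    unfolding locally_compact_space_def by blast
  moreover have "openin X U" using ch unfolding chart_def by blast
  ultimately show "\<exists>V K. openin X V \<and> compactin X K \<and> x \<in> V \<and> V \<subseteq> K"
    by (meson compactin_subtopology openin_trans_full)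
qed

text \<open>The Lindelof property gives countably many compact sets covering \<open>X\<close>. Each
  \<open>K (Suc n)\<close> joins a compact neighbourhood of \<open>K n\<close> with the next of
  these sets, and \<open>G n\<close> is squeezed in between.\<close>

lemma compact_exhaustion:
  assumes "Hausdorff_space X" "locally_compact_space X" "second_countable X"
  obtains K G :: "nat \<Rightarrow> 'a set"
  where "\<And>n. compactin X (K n)" "\<And>n. openin X (G n)" "\<And>n. K n \<subseteq> G n" "\<And>n. G n \<subseteq> K (Suc n)"
    "G 0 = {}" "(\<Union>n. K n) = topspace X"
proof -
  have "\<exists>V L. openin X V \<and> compactin X L \<and> C \<subseteq> V \<and> V \<subseteq> L" if "compactin X C" for C
    using assms that by (meson locally_compact_space_compact_closed_compact)
  then obtain g k where gk: "\<And>C. compactin X C \<Longrightarrow> openin X (g C) \<and> compactin X (k C) \<and> C \<subseteq> g C \<and> g C \<subseteq> k C"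
    by metis
  obtain v l where vl: "\<And>x. x \<in> topspace X \<Longrightarrow> openin X (v x) \<and> compactin X (l x) \<and> x \<in> v x \<and> v x \<subseteq> l x"
    using assms(2) unfolding locally_compact_space_def by metis
  have "\<exists>\<V>. countable \<V> \<and> \<V> \<subseteq> v ` topspace X \<and> topspace X \<subseteq> \<Union>\<V>"
  proof (rule second_countable_imp_Lindelof_space[OF assms(3), unfolded Lindelof_space_alt, rule_format])
    show "(\<forall>U\<in>v ` topspace X. openin X U) \<and> topspace X \<subseteq> \<Union>(v ` topspace X)"
      using vl by blast
  qed
  then obtain S where S: "countable S" "S \<subseteq> topspace X" "topspace X \<subseteq> \<Union>(v ` S)"
    by (metis countable_subset_image)
  \<comment> \<open>If \<open>X\<close> is empty then so is \<open>S\<close>, and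
    \<open>from_nat_into\<close> would return an arbitrary point; the case split keeps every
    \<open>L n\<close> compact.\<close>
  define L where "L n = (if S = {} then {} else l (from_nat_into S n))" for n
  have L: "compactin X (L n)" for n
    using vl S(2) from_nat_into[of S n] unfolding L_def by auto
  have L_cover: "topspace X \<subseteq> (\<Union>n. L n)"
  proof
    fix x assume "x \<in> topspace X"
    then obtain y where "y \<in> S" "x \<in> v y" using S(3) by blast
    then have "x \<in> L (to_nat_on S y)"
      using S vl unfolding L_def by auto
    then show "x \<in> (\<Union>n. L n)" by blast
  qed
  define K where "K = rec_nat {} (\<lambda>n C. k C \<union> L n)"
  have K0: "K 0 = {}" and KS: "K (Suc n) = k (K n) \<union> L n" for n
    unfolding K_def by simp_all
  have Kc: "compactin X (K n)" for n
    by (induction n) (auto simp: K0 KS gk L compactin_Un)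
  show ?thesis
  \<comment> \<open>\<open>g {}\<close> may be a nonempty open set, so \<open>G 0\<close> is made
    empty by hand; this is harmless because \<open>K 0\<close> is empty.\<close>
  proof (rule that[of K "\<lambda>n. if n = 0 then {} else g (K n)"])
    show "(\<Union>n. K n) = topspace X"
    proof
      show "(\<Union>n. K n) \<subseteq> topspace X"
        using compactin_subset_topspace[OF Kc] by (rule UN_least)
      show "topspace X \<subseteq> (\<Union>n. K n)"
        using L_cover KS by blast
    qed
  qed (use Kc gk KS K0 in auto)
qed

text \<open>Each \<open>D n\<close> lies inside \<open>K (2 * n + 3)\<close> and misses
  \<open>K (2 * n - 1)\<close>. If \<open>n + 2 \<le> m\<close> then
  \<open>2 * n + 3 \<le> 2 * m - 1\<close>, so \<open>D m\<close> misses a set that contains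
  \<open>D n\<close>. The open \<open>D n\<close> leaves room to cover the compact
  \<open>A n\<close> by smaller open sets.\<close>

lemma compact_layers:
  assumes "Hausdorff_space X" "locally_compact_space X" "second_countable X"
  obtains A D :: "nat \<Rightarrow> 'a set"
  where "\<And>n. compactin X (A n)" "\<And>n. openin X (D n)" "\<And>n. A n \<subseteq> D n"
    "\<And>m n. n + 2 \<le> m \<Longrightarrow> D n \<inter> D m = {}" "(\<Union>n. A n) = topspace X"
proof -
  obtain K G :: "nat \<Rightarrow> 'a set" where K: "\<And>n. compactin X (K n)" and G: "\<And>n. openin X (G n)"
    and KG: "\<And>n. K n \<subseteq> G n" and GK: "\<And>n. G n \<subseteq> K (Suc n)" and G0: "G 0 = {}"
    and cover: "(\<Union>n. K n) = topspace X"
    using compact_exhaustion[OF assms] by metis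
  have closed: "closedin X (K n)" for n
    using K assms(1) compactin_imp_closedin by blast
  have mono: "K m \<subseteq> K n" if "m \<le> n" for m n
    using that by (rule lift_Suc_mono_le[rotated]) (use KG GK in blast)
  \<comment> \<open>For \<open>n = 0\<close> the index \<open>2 * n - 1\<close> is \<open>0\<close>, where both \<open>G\<close> and \<open>K\<close> are empty.\<close>
  define A where "A n = K (2 * n + 2) - G (2 * n - 1)" for n
  define D where "D n = G (2 * n + 2) - K (2 * n - 1)" for n
  show ?thesis
  proof (rule that[of A D])
    fix n
    show "compactin X (A n)"
      unfolding A_def using K G
      by (metis Diff_subset closed closed_compactin closedin_diff)
    show "openin X (D n)" unfolding D_def using G closed by (simp add: openin_diff)
    show "A n \<subseteq> D n" unfolding A_def D_def using KG by blast
  next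
    fix m n :: nat assume "n + 2 \<le> m"
    then have "2 * n + 3 \<le> 2 * m - 1" by simp
    then have "K (2 * n + 3) \<subseteq> K (2 * m - 1)" by (rule mono)
    moreover have "G (2 * n + 2) \<subseteq> K (2 * n + 3)" using GK[of "2 * n + 2"] by (simp add: eval_nat_numeral)
    ultimately show "D n \<inter> D m = {}" unfolding D_def by blast
  next
    have "x \<in> (\<Union>n. A n)" if x: "x \<in> topspace X" for x
    proof -
      obtain n where "x \<in> K n" using x cover by blast
      then have "x \<in> K (2 * n + 2)" using mono[of n "2 * n + 2"] by auto
      \<comment> \<open>The least such \<open>m\<close> places \<open>x\<close> in
        \<open>A m\<close>: for positive \<open>m\<close>, minimality keeps \<open>x\<close> out of
        \<open>K (2 * m)\<close>, which contains \<open>G (2 * m - 1)\<close>.\<close>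
      then obtain m where m: "x \<in> K (2 * m + 2)" "\<And>i. i < m \<Longrightarrow> x \<notin> K (2 * i + 2)"
        using exists_least_iff[of "\<lambda>m. x \<in> K (2 * m + 2)"] by blast
      have "x \<notin> G (2 * m - 1)"
      proof (cases m)
        case (Suc i)
        then show ?thesis using m(2)[of i] GK[of "2 * i + 1"] by auto
      qed (simp add: G0)
      with m(1) show ?thesis unfolding A_def by blast
    qed
    moreover have "A n \<subseteq> topspace X" for n unfolding A_def using K compactin_subset_topspace by blast
    ultimately show "(\<Union>n. A n) = topspace X" by blast
  qed
qed

section \<open>From basis sets to finite unions, and from these to all open sets\<close>

lemma union_of_basis_intersections:
  assumes empty: "P {}"
    and union: "\<And>U V. openin X U \<Longrightarrow> openin X V \<Longrightarrow> P U \<Longrightarrow> P V \<Longrightarrow> P (U \<inter> V) \<Longrightarrow> P (U \<union> V)"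
    and B: "\<And>U. U \<in> \<B> \<Longrightarrow> openin X U \<and> P U" "\<And>U V. U \<in> \<B> \<Longrightarrow> V \<in> \<B> \<Longrightarrow> U \<inter> V \<in> \<B>"
    and "finite \<F>" "\<F> \<subseteq> \<B>"
  shows "P (\<Union>\<F>)"
  using \<open>finite \<F>\<close> \<open>\<F> \<subseteq> \<B>\<close>
proof (induction "card \<F>" arbitrary: \<F> rule: less_induct)
  case less
  show ?case
  proof (cases "\<F> = {}")
    case False
    then obtain U where U: "U \<in> \<F>" by blast
    define \<G> where "\<G> = \<F> - {U}"
    have "card \<G> < card \<F>"
      unfolding \<G>_def using less.prems(1) U by (rule card_Diff1_less)
    then have G: "finite \<G>" "\<G> \<subseteq> \<B>" "card \<G> < card \<F>" "\<Union>\<F> = U \<union> \<Union>\<G>"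
      using less.prems U by (auto simp: \<G>_def)
    have "U \<in> \<B>" using U less.prems by blast
    \<comment> \<open>The intersection required by \<open>union\<close> is the union of the sets
      \<open>U \<inter> V\<close> with \<open>V \<in> \<G>\<close>. They lie in \<open>\<B>\<close>
      and number at most \<open>card \<G>\<close>, so the induction hypothesis covers them; some may
      coincide, hence the induction on all smaller cardinalities.\<close>
    have "P (\<Union>((\<inter>) U ` \<G>))"
    proof (rule less.hyps)
      show "card ((\<inter>) U ` \<G>) < card \<F>"
        using G card_image_le[of \<G> "(\<inter>) U"] by linarith
      show "finite ((\<inter>) U ` \<G>)" using G(1) by simp
      show "(\<inter>) U ` \<G> \<subseteq> \<B>" using G(2) B(2) \<open>U \<in> \<B>\<close> by blast
    qed
    then have "P (U \<inter> \<Union>\<G>)" by (simp only: Int_Union)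
    moreover have "openin X (\<Union>\<G>)" using G B(1) by blast
    ultimately show ?thesis
      unfolding G(4) using union B(1)[OF \<open>U \<in> \<B>\<close>] less.hyps[OF G(3,1,2)] by blast
  qed (simp add: empty)
qed

text \<open>Here \<open>P\<close> is an arbitrary predicate, so that one topological argument serves
  both presheaves and precosheaves. Splitting by parity works because only neighbouring sets meet,
  which makes the overlap of the two halves a disjoint union as well.\<close>

proposition openin_basis_induct:
  assumes X: "Hausdorff_space X" "locally_compact_space X" "second_countable X"
    and basis: "topology_basis X \<UU>"
    and inter: "\<And>\<V>. finite \<V> \<Longrightarrow> \<V> \<noteq> {} \<Longrightarrow> \<V> \<subseteq> \<UU> \<Longrightarrow> P (\<Inter>\<V>)"
    and empty: "P {}"
    and union: "\<And>U V. openin X U \<Longrightarrow> openin X V \<Longrightarrow> P U \<Longrightarrow> P V \<Longrightarrow> P (U \<inter> V) \<Longrightarrow> P (U \<union> V)"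
    and disjoint: "\<And>U :: nat \<Rightarrow> 'a set. (\<And>n. openin X (U n)) \<Longrightarrow> disjoint_family U \<Longrightarrow> (\<And>n. P (U n)) \<Longrightarrow> P (\<Union>n. U n)"
    and U: "openin X U"
  shows "P U"
proof -
  \<comment> \<open>The basis is closed under finite intersections first. Empty families are
    excluded because \<open>\<Inter>{}\<close> is \<open>UNIV\<close> and not
    \<open>topspace X\<close>.\<close>
  define \<B> where "\<B> = Inter ` {\<V>. finite \<V> \<and> \<V> \<noteq> {} \<and> \<V> \<subseteq> \<UU>}"
  have basis_open: "openin X V" if "V \<in> \<UU>" for V
    using basis that unfolding topology_basis_def openin_topology_base_unique by blast
  have B: "openin X V \<and> P V" if "V \<in> \<B>" for V
    using that inter basis_open unfolding \<B>_def by (auto intro!: openin_Inter)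
  have B_Int: "V \<inter> W \<in> \<B>" if VW: "V \<in> \<B>" "W \<in> \<B>" for V W
  proof -
    obtain \<V> \<W> where "V = \<Inter>\<V>" "W = \<Inter>\<W>" "finite \<V>" "\<V> \<noteq> {}" "\<V> \<subseteq> \<UU>" "finite \<W>" "\<W> \<subseteq> \<UU>"
      using VW unfolding \<B>_def by blast
    then show ?thesis unfolding \<B>_def by (intro image_eqI[of _ _ "\<V> \<union> \<W>"]) auto
  qed
  have basis_B: "\<UU> \<subseteq> \<B>"
    unfolding \<B>_def by (auto intro!: image_eqI[of _ _ "{_}"])
  note fin = union_of_basis_intersections[where P = P and X = X and \<B> = \<B>, OF empty union B B_Int]
  \<comment> \<open>The layers are built in the subspace \<open>U\<close>; as \<open>U\<close> is
    open, their open sets remain open in \<open>X\<close>.\<close>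
  have "locally_compact_space (subtopology X U)"
    using X U by (intro locally_compact_space_open_subset) auto
  then obtain A D :: "nat \<Rightarrow> 'a set"
    where A: "\<And>n. compactin (subtopology X U) (A n)" and D: "\<And>n. openin (subtopology X U) (D n)"
      and AD: "\<And>n. A n \<subseteq> D n" and DD: "\<And>m n. n + 2 \<le> m \<Longrightarrow> D n \<inter> D m = {}"
      and cover: "(\<Union>n. A n) = topspace (subtopology X U)"
    using compact_layers X by (metis Hausdorff_space_subtopology second_countable_subtopology)
  have D_open: "openin X (D n)" and D_sub: "D n \<subseteq> U" for n
    using D U by (auto simp: openin_open_subtopology)
  \<comment> \<open>The basis sets are chosen inside \<open>D n\<close>, so that their union
    \<open>W n\<close> inherits the disjointness of non-neighbouring layers.\<close>
  have "\<exists>\<F>. finite \<F> \<and> \<F> \<subseteq> \<UU> \<and> A n \<subseteq> \<Union>\<F> \<and> \<Union>\<F> \<subseteq> D n" for n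
  proof -
    have "compactin X (A n)" using A compactin_subtopology by blast
    moreover have "A n \<subseteq> \<Union>{V \<in> \<UU>. V \<subseteq> D n}"
      using AD[of n] D_open[of n] basis unfolding topology_basis_def openin_topology_base_unique by blast
    ultimately obtain \<F> where "finite \<F>" "\<F> \<subseteq> {V \<in> \<UU>. V \<subseteq> D n}" "A n \<subseteq> \<Union>\<F>"
      using basis_open unfolding compactin_def by (metis (no_types, lifting) mem_Collect_eq)
    then show ?thesis by (intro exI[of _ \<F>]) auto
  qed
  then obtain \<F> where F: "\<And>n. finite (\<F> n)" "\<And>n. \<F> n \<subseteq> \<UU>" "\<And>n. A n \<subseteq> \<Union>(\<F> n)" "\<And>n. \<Union>(\<F> n) \<subseteq> D n"
    by metis
  define W where "W n = \<Union>(\<F> n)" for n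
  have W_open: "openin X (W n)" for n
    unfolding W_def using F(2) basis_open by blast
  have W_disj: "W n \<inter> W m = {}" if "n + 2 \<le> m" for m n
    using DD[OF that] F(4) unfolding W_def by blast
  have PW: "P (W n)" for n
    unfolding W_def using F(1,2) basis_B by (intro fin) blast+
  \<comment> \<open>Pairwise intersections may leave the basis but stay in \<open>\<B>\<close>, so
    \<open>fin\<close> still applies to their finite union.\<close>
  have PWW: "P (W n \<inter> W (Suc n))" for n
  proof -
    have "W n \<inter> W (Suc n) = \<Union>((\<lambda>(V, V'). V \<inter> V') ` (\<F> n \<times> \<F> (Suc n)))"
      unfolding W_def by auto
    moreover have "P \<dots>"
    proof (rule fin)
      show "(\<lambda>(V, V'). V \<inter> V') ` (\<F> n \<times> \<F> (Suc n)) \<subseteq> \<B>"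
        using F(2) basis_B by (auto intro!: B_Int)
    qed (use F(1) in auto)
    ultimately show ?thesis by simp
  qed
  let ?E = "\<Union>n. W (2 * n)" and ?O = "\<Union>n. W (2 * n + 1)"
  have "P ?E"
  proof (rule disjoint)
    have "W (2 * n) \<inter> W (2 * m) = {}" if "n < m" for n m using that by (intro W_disj) simp
    then show "disjoint_family (\<lambda>n. W (2 * n))"
      unfolding disjoint_family_on_def by (metis Int_commute nat_neq_iff)
  qed (use W_open PW in auto)
  moreover have "P ?O"
  proof (rule disjoint)
    have "W (2 * n + 1) \<inter> W (2 * m + 1) = {}" if "n < m" for n m using that by (intro W_disj) simp
    then show "disjoint_family (\<lambda>n. W (2 * n + 1))"
      unfolding disjoint_family_on_def by (metis Int_commute nat_neq_iff)
  qed (use W_open PW in auto)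
  moreover have "P (?E \<inter> ?O)"
  proof -
    \<comment> \<open>An even and an odd index whose sets meet must be consecutive.\<close>
    have "?E \<inter> ?O = (\<Union>n. W n \<inter> W (Suc n))"
    proof safe
      fix x n m assume "x \<in> W (2 * n)" "x \<in> W (2 * m + 1)"
      moreover from this have "\<not> 2 * n + 2 \<le> 2 * m + 1" "\<not> 2 * m + 1 + 2 \<le> 2 * n"
        using W_disj by blast+
      then have "m = n \<or> n = Suc m" by linarith
      ultimately show "x \<in> (\<Union>n. W n \<inter> W (Suc n))"
        by (auto intro: UN_I[of "2 * n"] UN_I[of "2 * m + 1"])
    next
      fix x n assume x: "x \<in> W n" "x \<in> W (Suc n)"
      consider k where "n = 2 * k" | k where "n = 2 * k + 1" by (metis evenE oddE)
      then have "(\<exists>k. x \<in> W (2 * k)) \<and> (\<exists>k. x \<in> W (2 * k + 1))"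
      proof cases
        case 1
        then show ?thesis using x by auto
      next
        case (2 k)
        then have "x \<in> W (2 * Suc k)" using x by simp
        then show ?thesis using x 2 by blast
      qed
      then show "x \<in> ?E" "x \<in> ?O" by blast+
    qed
    moreover have "P \<dots>"
    proof (rule disjoint)
      \<comment> \<open>The indices of the factors \<open>W n\<close> and \<open>W (Suc m)\<close>
        are at least two apart, and these two alone have empty intersection.\<close>
      have "(W n \<inter> W (Suc n)) \<inter> (W m \<inter> W (Suc m)) = {}" if "n < m" for n m
        using that W_disj[of n "Suc m"] by auto
      then show "disjoint_family (\<lambda>n. W n \<inter> W (Suc n))"
        unfolding disjoint_family_on_def by (metis Int_commute nat_neq_iff)
    qed (use W_open PWW in auto)
    ultimately show ?thesis by simp
  qed
  ultimately have "P (?E \<union> ?O)" using W_open by (intro union) auto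
  moreover have "?E \<union> ?O = (\<Union>n. W n)"
  proof -
    have "W n \<subseteq> ?E \<union> ?O" for n
    proof -
      consider k where "n = 2 * k" | k where "n = 2 * k + 1" by (metis evenE oddE)
      then show ?thesis by cases blast+
    qed
    then show ?thesis by blast
  qed
  moreover have "(\<Union>n. W n) = U"
  proof
    show "(\<Union>n. W n) \<subseteq> U" using F(4) D_sub unfolding W_def by blast
    have "U \<subseteq> (\<Union>n. A n)" using cover openin_subset[OF U] by auto
    also have "\<dots> \<subseteq> (\<Union>n. W n)" unfolding W_def using F(3) by (rule UN_mono[OF order_refl])
    finally show "U \<subseteq> (\<Union>n. W n)" .
  qed
  ultimately show ?thesis by simp
qed

section \<open>Homological algebra\<close>

lemma mod_homD:
  assumes "h \<in> mod_hom R M N"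
  shows "\<And>x. x \<in> carrier M \<Longrightarrow> h x \<in> carrier N"
    and "\<And>x y. x \<in> carrier M \<Longrightarrow> y \<in> carrier M \<Longrightarrow> h (x \<oplus>\<^bsub>M\<^esub> y) = h x \<oplus>\<^bsub>N\<^esub> h y"
  using assms unfolding mod_hom_def by auto

text \<open>Bijectivity concerns only the additive groups, so the diagram chases forget the scalars.
  Maps into and between direct sums then enter with additivity as the essential check.\<close>

lemma abelian_group_homI_add:
  assumes "abelian_group M" "abelian_group N"
    and "\<And>x. x \<in> carrier M \<Longrightarrow> h x \<in> carrier N"
    and "\<And>x y. x \<in> carrier M \<Longrightarrow> y \<in> carrier M \<Longrightarrow> h (x \<oplus>\<^bsub>M\<^esub> y) = h x \<oplus>\<^bsub>N\<^esub> h y"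
  shows "abelian_group_hom M N h"
  using assms
  by (intro abelian_group_homI group_hom.intro group_hom_axioms.intro)
    (auto simp: hom_def intro: abelian_group.a_group)

lemma mod_hom_abelian_group_hom:
  assumes "abelian_group M" "abelian_group N" "h \<in> mod_hom R M N"
  shows "abelian_group_hom M N h"
  using assms mod_homD[OF assms(3)] by (intro abelian_group_homI_add) auto

lemma abelian_group_mod_sum2:
  assumes "abelian_group M" "abelian_group N"
  shows "abelian_group (mod_sum2 M N)"
proof -
  interpret M: abelian_group M by fact
  interpret N: abelian_group N by fact
  show ?thesis
  proof (rule abelian_groupI)
    fix x assume "x \<in> carrier (mod_sum2 M N)"
    then show "\<exists>y\<in>carrier (mod_sum2 M N). y \<oplus>\<^bsub>mod_sum2 M N\<^esub> x = \<zero>\<^bsub>mod_sum2 M N\<^esub>"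
      by (intro bexI[of _ "(\<ominus>\<^bsub>M\<^esub> fst x, \<ominus>\<^bsub>N\<^esub> snd x)"]) (auto simp: mod_sum2_def M.l_neg N.l_neg)
  qed (auto simp: mod_sum2_def M.a_ac N.a_ac)
qed

lemma mod_exactD:
  assumes "mod_exact A f B g C"
  shows "\<And>x. x \<in> carrier A \<Longrightarrow> f x \<in> carrier B"
    and "\<And>x. x \<in> carrier A \<Longrightarrow> g (f x) = \<zero>\<^bsub>C\<^esub>"
    and "\<And>y. y \<in> carrier B \<Longrightarrow> g y = \<zero>\<^bsub>C\<^esub> \<Longrightarrow> \<exists>x\<in>carrier A. y = f x"
  using assms unfolding mod_exact_def a_kernel_def' by blast+

text \<open>A diagram chase in which \<open>h\<^sub>1\<close> need only be surjective and
  \<open>h\<^sub>5\<close> injective. The assumption \<open>f4\<close> is stated separately because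
  exactness at \<open>A\<^sub>4\<close> constrains only the kernel of \<open>f\<^sub>4\<close>, not
  where its other values lie.\<close>

lemma five_lemma:
  assumes f: "mod_exact A\<^sub>1 f\<^sub>1 A\<^sub>2 f\<^sub>2 A\<^sub>3" "mod_exact A\<^sub>2 f\<^sub>2 A\<^sub>3 f\<^sub>3 A\<^sub>4" "mod_exact A\<^sub>3 f\<^sub>3 A\<^sub>4 f\<^sub>4 A\<^sub>5"
    and g: "mod_exact B\<^sub>1 g\<^sub>1 B\<^sub>2 g\<^sub>2 B\<^sub>3" "mod_exact B\<^sub>2 g\<^sub>2 B\<^sub>3 g\<^sub>3 B\<^sub>4" "mod_exact B\<^sub>3 g\<^sub>3 B\<^sub>4 g\<^sub>4 B\<^sub>5"
    and f4: "\<And>x. x \<in> carrier A\<^sub>4 \<Longrightarrow> f\<^sub>4 x \<in> carrier A\<^sub>5"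
    and g3: "abelian_group_hom B\<^sub>3 B\<^sub>4 g\<^sub>3" and h3: "abelian_group_hom A\<^sub>3 B\<^sub>3 h\<^sub>3"
    and h4: "abelian_group_hom A\<^sub>4 B\<^sub>4 h\<^sub>4" and h5: "abelian_group_hom A\<^sub>5 B\<^sub>5 h\<^sub>5"
    and comm: "\<And>x. x \<in> carrier A\<^sub>1 \<Longrightarrow> h\<^sub>2 (f\<^sub>1 x) = g\<^sub>1 (h\<^sub>1 x)"
      "\<And>x. x \<in> carrier A\<^sub>2 \<Longrightarrow> h\<^sub>3 (f\<^sub>2 x) = g\<^sub>2 (h\<^sub>2 x)"
      "\<And>x. x \<in> carrier A\<^sub>3 \<Longrightarrow> h\<^sub>4 (f\<^sub>3 x) = g\<^sub>3 (h\<^sub>3 x)"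
      "\<And>x. x \<in> carrier A\<^sub>4 \<Longrightarrow> h\<^sub>5 (f\<^sub>4 x) = g\<^sub>4 (h\<^sub>4 x)"
    and bij: "h\<^sub>1 ` carrier A\<^sub>1 = carrier B\<^sub>1" "bij_betw h\<^sub>2 (carrier A\<^sub>2) (carrier B\<^sub>2)"
      "bij_betw h\<^sub>4 (carrier A\<^sub>4) (carrier B\<^sub>4)" "inj_on h\<^sub>5 (carrier A\<^sub>5)"
  shows "bij_betw h\<^sub>3 (carrier A\<^sub>3) (carrier B\<^sub>3)"
proof -
  interpret g3: abelian_group_hom B\<^sub>3 B\<^sub>4 g\<^sub>3 by fact
  interpret h3: abelian_group_hom A\<^sub>3 B\<^sub>3 h\<^sub>3 by fact
  interpret h4: abelian_group_hom A\<^sub>4 B\<^sub>4 h\<^sub>4 by fact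
  interpret h5: abelian_group_hom A\<^sub>5 B\<^sub>5 h\<^sub>5 by fact
  \<comment> \<open>An element \<open>x\<close> of the kernel is \<open>f\<^sub>2 y\<close> for some
    \<open>y\<close>, and \<open>h\<^sub>2 y\<close> comes from \<open>B\<^sub>1\<close>, hence from
    \<open>A\<^sub>1\<close> by surjectivity of \<open>h\<^sub>1\<close>. Injectivity of
    \<open>h\<^sub>2\<close> makes \<open>y\<close> an image under \<open>f\<^sub>1\<close>, so
    \<open>x\<close> vanishes by exactness.\<close>
  have "x = \<zero>\<^bsub>A\<^sub>3\<^esub>" if x: "x \<in> carrier A\<^sub>3" "h\<^sub>3 x = \<zero>\<^bsub>B\<^sub>3\<^esub>" for x
  proof -
    have "h\<^sub>4 (f\<^sub>3 x) = h\<^sub>4 \<zero>\<^bsub>A\<^sub>4\<^esub>" using comm(3) x by simp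
    then have "f\<^sub>3 x = \<zero>\<^bsub>A\<^sub>4\<^esub>"
      using bij(3) x mod_exactD(1)[OF f(3)] by (meson bij_betw_imp_inj_on h4.G.zero_closed inj_onD)
    then obtain y where y: "y \<in> carrier A\<^sub>2" "x = f\<^sub>2 y" using mod_exactD(3)[OF f(2)] x by blast
    then have "g\<^sub>2 (h\<^sub>2 y) = \<zero>\<^bsub>B\<^sub>3\<^esub>" using comm(2) x by simp
    moreover have "h\<^sub>2 y \<in> carrier B\<^sub>2" using bij(2) y bij_betwE by blast
    ultimately obtain z' where "z' \<in> carrier B\<^sub>1" "h\<^sub>2 y = g\<^sub>1 z'"
      using mod_exactD(3)[OF g(1)] by blast
    then obtain z where z: "z \<in> carrier A\<^sub>1" "h\<^sub>2 y = g\<^sub>1 (h\<^sub>1 z)"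
      using bij(1) by (metis imageE)
    then have "h\<^sub>2 (f\<^sub>1 z) = h\<^sub>2 y" using comm(1) by simp
    then have "f\<^sub>1 z = y"
      using bij(2) y z mod_exactD(1)[OF f(1)] by (meson bij_betw_imp_inj_on inj_onD)
    then show ?thesis using y z mod_exactD(2)[OF f(1)] by metis
  qed
  then have inj: "inj_on h\<^sub>3 (carrier A\<^sub>3)"
    using group_hom.inj_iff_trivial_ker[OF h3.a_group_hom] by (auto simp: kernel_def)
  have "\<exists>x\<in>carrier A\<^sub>3. h\<^sub>3 x = y" if y: "y \<in> carrier B\<^sub>3" for y
  proof -
    have "g\<^sub>3 y \<in> carrier B\<^sub>4" using y by simp
    then obtain x where x: "x \<in> carrier A\<^sub>4" "h\<^sub>4 x = g\<^sub>3 y" using bij(3) by (metis bij_betwE bij_betw_imp_surj_on imageE)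
    then have "h\<^sub>5 (f\<^sub>4 x) = g\<^sub>4 (g\<^sub>3 y)" using comm(4) by simp
    also have "\<dots> = h\<^sub>5 \<zero>\<^bsub>A\<^sub>5\<^esub>" using mod_exactD(2)[OF g(3)] y by simp
    finally have "f\<^sub>4 x = \<zero>\<^bsub>A\<^sub>5\<^esub>" using bij(4) x f4 by (meson h5.G.zero_closed inj_onD)
    then obtain z where z: "z \<in> carrier A\<^sub>3" "x = f\<^sub>3 z" using mod_exactD(3)[OF f(3)] x by blast
    \<comment> \<open>\<open>z\<close> has the right image in \<open>B\<^sub>4\<close> but perhaps
      not in \<open>B\<^sub>3\<close>. The error is killed by \<open>g\<^sub>3\<close>, so it comes
      from \<open>A\<^sub>2\<close> and the correction can be added to \<open>z\<close>.\<close>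
    have d: "y \<ominus>\<^bsub>B\<^sub>3\<^esub> h\<^sub>3 z \<in> carrier B\<^sub>3" using y z by simp
    have eq: "(y \<ominus>\<^bsub>B\<^sub>3\<^esub> h\<^sub>3 z) \<oplus>\<^bsub>B\<^sub>3\<^esub> h\<^sub>3 z = y"
      using y z by (simp add: a_minus_def g3.G.a_assoc g3.G.l_neg)
    have "g\<^sub>3 y = g\<^sub>3 (h\<^sub>3 z)" using x z comm(3) by simp
    then have "g\<^sub>3 (y \<ominus>\<^bsub>B\<^sub>3\<^esub> h\<^sub>3 z) = \<zero>\<^bsub>B\<^sub>4\<^esub>"
      using y z by (simp add: a_minus_def g3.H.r_neg)
    then obtain w' where "w' \<in> carrier B\<^sub>2" "y \<ominus>\<^bsub>B\<^sub>3\<^esub> h\<^sub>3 z = g\<^sub>2 w'"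
      using mod_exactD(3)[OF g(2) d] by blast
    then obtain w where w: "w \<in> carrier A\<^sub>2" "y \<ominus>\<^bsub>B\<^sub>3\<^esub> h\<^sub>3 z = g\<^sub>2 (h\<^sub>2 w)"
      using bij(2) by (metis bij_betw_imp_surj_on imageE)
    then have "f\<^sub>2 w \<in> carrier A\<^sub>3" "h\<^sub>3 (f\<^sub>2 w \<oplus>\<^bsub>A\<^sub>3\<^esub> z) = y"
      using mod_exactD(1)[OF f(2)] z eq comm(2)[of w] by auto
    then show ?thesis using z by blast
  qed
  then show ?thesis using inj unfolding bij_betw_def by force
qed

lemma mod_iso_zero:
  assumes "abelian_group M" "abelian_group N" "h \<in> mod_hom R M N"
    and "carrier M \<subseteq> {\<zero>\<^bsub>M\<^esub>}" "carrier N \<subseteq> {\<zero>\<^bsub>N\<^esub>}"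
  shows "h \<in> mod_iso R M N"
proof -
  interpret abelian_group_hom M N h by (rule mod_hom_abelian_group_hom) fact+
  have "carrier M = {\<zero>\<^bsub>M\<^esub>}" "carrier N = {\<zero>\<^bsub>N\<^esub>}" using assms(4,5) by auto
  then show ?thesis using assms(3) unfolding mod_iso_def bij_betw_def by simp
qed

lemma mod_sum2_hom:
  assumes "abelian_group_hom A B h" "abelian_group_hom A' B' h'"
  shows "abelian_group_hom (mod_sum2 A A') (mod_sum2 B B') (map_prod h h')"
proof -
  interpret h: abelian_group_hom A B h by fact
  interpret h': abelian_group_hom A' B' h' by fact
  show ?thesis
    by (intro abelian_group_homI_add abelian_group_mod_sum2 h.is_abelian_group_hom h.G.abelian_group_axioms
        h.H.abelian_group_axioms h'.G.abelian_group_axioms h'.H.abelian_group_axioms)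
      (auto simp: mod_sum2_def)
qed

lemma bij_betw_mod_sum2:
  assumes "bij_betw h (carrier A) (carrier B)" "bij_betw h' (carrier A') (carrier B')"
  shows "bij_betw (map_prod h h') (carrier (mod_sum2 A A')) (carrier (mod_sum2 B B'))"
  using assms unfolding mod_sum2_def by (simp add: bij_betw_map_prod)

section \<open>Presheaves and precosheaves\<close>

lemma presheaf_abelian_group:
  assumes "presheaf R X M r" "openin X U"
  shows "abelian_group (M U)"
proof (rule Module.module.axioms(2))
  show "Module.module R (M U)"
    using assms(1)[unfolded presheaf_def, THEN conjunct1] assms(2) by blast
qed

lemma presheaf_mod_hom:
  assumes "presheaf R X M r" "openin X U" "openin X V" "V \<subseteq> U"
  shows "r U V \<in> mod_hom R (M U) (M V)"
  using assms(1)[unfolded presheaf_def, THEN conjunct2, THEN conjunct1] assms(2-) by blast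

lemma presheaf_id:
  assumes "presheaf R X M r" "openin X U" "x \<in> carrier (M U)"
  shows "r U U x = x"
  using assms(1)[unfolded presheaf_def, THEN conjunct2, THEN conjunct2, THEN conjunct1] assms(2-) by blast

lemma presheaf_morphism_mod_hom:
  assumes "presheaf_morphism R X M r N s f" "openin X U"
  shows "f U \<in> mod_hom R (M U) (N U)"
  using assms(1)[unfolded presheaf_morphism_def, THEN conjunct1] assms(2) by blast

lemma presheaf_morphism_natural:
  assumes "presheaf_morphism R X M r N s f" "openin X U" "openin X V" "V \<subseteq> U" "x \<in> carrier (M U)"
  shows "f V (r U V x) = s U V (f U x)"
  using assms(1)[unfolded presheaf_morphism_def, THEN conjunct2] assms(2-) by blast

lemma precosheaf_abelian_group:
  assumes "precosheaf R X M r" "openin X U"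
  shows "abelian_group (M U)"
proof (rule Module.module.axioms(2))
  show "Module.module R (M U)"
    using assms(1)[unfolded precosheaf_def, THEN conjunct1] assms(2) by blast
qed

lemma precosheaf_mod_hom:
  assumes "precosheaf R X M r" "openin X U" "openin X V" "V \<subseteq> U"
  shows "r V U \<in> mod_hom R (M V) (M U)"
  using assms(1)[unfolded precosheaf_def, THEN conjunct2, THEN conjunct1] assms(2-) by blast

lemma precosheaf_id:
  assumes "precosheaf R X M r" "openin X U" "x \<in> carrier (M U)"
  shows "r U U x = x"
  using assms(1)[unfolded precosheaf_def, THEN conjunct2, THEN conjunct2, THEN conjunct1] assms(2-) by blast

lemma precosheaf_morphism_mod_hom:
  assumes "precosheaf_morphism R X M r N s f" "openin X U"
  shows "f U \<in> mod_hom R (M U) (N U)"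
  using assms(1)[unfolded precosheaf_morphism_def, THEN conjunct1] assms(2) by blast

lemma precosheaf_morphism_natural:
  assumes "precosheaf_morphism R X M r N s f" "openin X U" "openin X V" "V \<subseteq> U" "x \<in> carrier (M V)"
  shows "f U (r V U x) = s V U (f V x)"
  using assms(1)[unfolded precosheaf_morphism_def, THEN conjunct2] assms(2-) by blast

section \<open>Products and direct sums: the empty set and countable disjoint unions\<close>

lemma (in abelian_group_hom) hom_finsum:
  assumes "f \<in> A \<rightarrow> carrier G"
  shows "h (finsum G f A) = finsum H (\<lambda>i. h (f i)) A"
  using assms by (induction A rule: infinite_finite_induct) (auto simp: Pi_def)

lemma bij_betw_PiE:
  assumes "\<And>i. i \<in> I \<Longrightarrow> bij_betw (g i) (A i) (B i)"
  shows "bij_betw (\<lambda>x. \<lambda>i\<in>I. g i (x i)) (\<Pi>\<^sub>E i\<in>I. A i) (\<Pi>\<^sub>E i\<in>I. B i)"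
proof (rule bij_betw_byWitness[where f' = "\<lambda>y. \<lambda>i\<in>I. inv_into (A i) (g i) (y i)"])
  show "\<forall>x\<in>\<Pi>\<^sub>E i\<in>I. A i. (\<lambda>i\<in>I. inv_into (A i) (g i) ((\<lambda>i\<in>I. g i (x i)) i)) = x"
    by (intro ballI ext) (auto simp: PiE_def extensional_def Pi_iff bij_betw_inv_into_left[OF assms])
  show "\<forall>y\<in>\<Pi>\<^sub>E i\<in>I. B i. (\<lambda>i\<in>I. g i ((\<lambda>i\<in>I. inv_into (A i) (g i) (y i)) i)) = y"
    by (intro ballI ext) (auto simp: PiE_def extensional_def Pi_iff bij_betw_inv_into_right[OF assms])
  show "(\<lambda>x. \<lambda>i\<in>I. g i (x i)) ` (\<Pi>\<^sub>E i\<in>I. A i) \<subseteq> (\<Pi>\<^sub>E i\<in>I. B i)"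
    using bij_betwE[OF assms] by (fastforce intro!: restrict_PiE_iff[THEN iffD2])
  show "(\<lambda>y. \<lambda>i\<in>I. inv_into (A i) (g i) (y i)) ` (\<Pi>\<^sub>E i\<in>I. B i) \<subseteq> (\<Pi>\<^sub>E i\<in>I. A i)"
    using bij_betwE[OF bij_betw_inv_into[OF assms]] by (fastforce intro!: restrict_PiE_iff[THEN iffD2])
qed

text \<open>Serves to cut a bijection of full products down to the finitely supported families of
  the direct sums.\<close>

lemma bij_betw_Collect:
  assumes "bij_betw h A B" "\<And>x. x \<in> A \<Longrightarrow> Q (h x) \<longleftrightarrow> P x"
  shows "bij_betw h {x \<in> A. P x} {y \<in> B. Q y}"
proof (rule bij_betw_subset[OF assms(1)])
  show "h ` {x \<in> A. P x} = {y \<in> B. Q y}"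
    unfolding bij_betw_imp_surj_on[OF assms(1), symmetric] using assms(2) by auto
qed blast

text \<open>The constant family of empty sets is disjoint. Its comparison map is the diagonal into a
  product of copies of one module, which is onto only if that module vanishes.\<close>

lemma cdp_presheaf_empty:
  assumes "cdp_presheaf R X M r" and x: "x \<in> carrier (M {})"
  shows "x = \<zero>\<^bsub>M {}\<^esub>"
proof -
  have M: "presheaf R X M r" using assms(1) unfolding cdp_presheaf_def by blast
  interpret abelian_group "M {}" using M by (rule presheaf_abelian_group) simp
  let ?\<Phi> = "\<lambda>x. \<lambda>n\<in>{1::nat..}. r {} {} x"
  \<comment> \<open>\<open>x\<close> at the first index and zero elsewhere; as an element of the
    diagonal it has equal entries at 1 and 2.\<close>
  define y where "y = (\<lambda>n\<in>{1::nat..}. if n = 1 then x else \<zero>\<^bsub>M {}\<^esub>)"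
  have "?\<Phi> \<in> mod_iso R (M {}) (mod_prod {1..} (\<lambda>n. M {}))"
    using assms(1)[unfolded cdp_presheaf_def, THEN conjunct2, rule_format, of "\<lambda>_. {}"]
    by (simp add: disjoint_family_on_def)
  then have "?\<Phi> ` carrier (M {}) = carrier (mod_prod {1..} (\<lambda>n. M {}))"
    unfolding mod_iso_def bij_betw_def by blast
  moreover have "y \<in> carrier (mod_prod {1..} (\<lambda>n. M {}))"
    using x unfolding y_def mod_prod_def by auto
  ultimately have "y \<in> ?\<Phi> ` carrier (M {})" by (simp only:)
  then obtain z where y: "y = ?\<Phi> z" and "z \<in> carrier (M {})" by (rule imageE)
  then have "r {} {} z = z"
    using presheaf_id[OF M openin_empty] by blast
  then have "y 1 = z" "y 2 = z" using y by auto
  then show ?thesis unfolding y_def by simp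
qed

text \<open>For the constant empty family the comparison map adds up finitely supported families in
  one module. Moving \<open>x\<close> from index 1 to index 2 keeps the sum, so injectivity forces
  \<open>x\<close> to vanish.\<close>

lemma cds_precosheaf_empty:
  assumes "cds_precosheaf R X M e" and x: "x \<in> carrier (M {})"
  shows "x = \<zero>\<^bsub>M {}\<^esub>"
proof (rule ccontr)
  assume nz: "x \<noteq> \<zero>\<^bsub>M {}\<^esub>"
  have M: "precosheaf R X M e" using assms(1) unfolding cds_precosheaf_def by blast
  interpret abelian_group "M {}" using M by (rule precosheaf_abelian_group) simp
  let ?\<Phi> = "mod_sum_map {1::nat..} (\<lambda>n. M {}) (M {}) (\<lambda>n. e {} {})"
  define y where "y k = (\<lambda>n\<in>{1::nat..}. if n = k then x else \<zero>\<^bsub>M {}\<^esub>)" for k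
  have "?\<Phi> \<in> mod_iso R (mod_dsum {1..} (\<lambda>n. M {})) (M {})"
    using assms(1)[unfolded cds_precosheaf_def, THEN conjunct2, rule_format, of "\<lambda>_. {}"]
    by (simp add: disjoint_family_on_def)
  then have inj: "inj_on ?\<Phi> (carrier (mod_dsum {1..} (\<lambda>n. M {})))"
    unfolding mod_iso_def bij_betw_def by blast
  \<comment> \<open>That \<open>x\<close> is nonzero makes the support exactly \<open>{k}\<close>,
    so the sum has a single term.\<close>
  have supp: "{n \<in> {1..}. y k n \<noteq> \<zero>\<^bsub>M {}\<^esub>} = {k}" if "k \<ge> 1" for k
    using nz that unfolding y_def by auto
  have "y k \<in> carrier (mod_dsum {1..} (\<lambda>n. M {}))" if "k \<ge> 1" for k
    using x supp[OF that] unfolding mod_dsum_def mod_prod_def by (auto simp: y_def)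
  moreover have "?\<Phi> (y k) = x" if "k \<ge> 1" for k
  proof -
    have "e {} {} x = x" using precosheaf_id[OF M openin_empty x] .
    then show ?thesis
      using x that unfolding mod_sum_map_def supp[OF that] by (simp add: y_def)
  qed
  ultimately have "y 1 = y 2" by (intro inj_onD[OF inj]) auto
  then have "y 1 1 = y 2 1" by simp
  then show False using nz unfolding y_def by simp
qed

text \<open>Naturality gives \<open>?\<Psi> \<circ> f W = ?G \<circ> ?\<Phi>\<close> on
  \<open>M W\<close>. The comparison maps are bijective by the cdp condition and \<open>?G\<close>
  is a product of bijections, so \<open>f W\<close> is bijective too.\<close>

lemma presheaf_morphism_iso_Union:
  assumes M: "cdp_presheaf R X M r" and N: "cdp_presheaf R X N s"
    and f: "presheaf_morphism R X M r N s f"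
    and U: "\<And>n::nat. n \<ge> 1 \<Longrightarrow> openin X (U n)" "disjoint_family_on U {1..}"
    and iso: "\<And>n. n \<ge> 1 \<Longrightarrow> f (U n) \<in> mod_iso R (M (U n)) (N (U n))"
  shows "f (\<Union>n\<in>{1..}. U n) \<in> mod_iso R (M (\<Union>n\<in>{1..}. U n)) (N (\<Union>n\<in>{1..}. U n))"
proof -
  define W where "W = (\<Union>n\<in>{1..}. U n)"
  let ?\<Phi> = "\<lambda>x. \<lambda>n\<in>{1..}. r W (U n) x" and ?\<Psi> = "\<lambda>x. \<lambda>n\<in>{1..}. s W (U n) x"
  let ?G = "\<lambda>x. \<lambda>n\<in>{1..}. f (U n) (x n)"
  have W: "openin X W" unfolding W_def using U(1) by auto
  have U_le: "U n \<subseteq> W" if "n \<ge> 1" for n unfolding W_def using that by auto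
  have fW: "f W \<in> mod_hom R (M W) (N W)" using f W by (rule presheaf_morphism_mod_hom)
  have bM: "bij_betw ?\<Phi> (carrier (M W)) (\<Pi>\<^sub>E n\<in>{1..}. carrier (M (U n)))"
    using M U unfolding cdp_presheaf_def mod_iso_def mod_prod_def W_def by auto
  have bN: "bij_betw ?\<Psi> (carrier (N W)) (\<Pi>\<^sub>E n\<in>{1..}. carrier (N (U n)))"
    using N U unfolding cdp_presheaf_def mod_iso_def mod_prod_def W_def by auto
  have bG: "bij_betw ?G (\<Pi>\<^sub>E n\<in>{1..}. carrier (M (U n))) (\<Pi>\<^sub>E n\<in>{1..}. carrier (N (U n)))"
    using iso unfolding mod_iso_def by (intro bij_betw_PiE) auto
  have "(?G \<circ> ?\<Phi>) x = (?\<Psi> \<circ> f W) x" if "x \<in> carrier (M W)" for x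
  proof -
    have "f (U n) (r W (U n) x) = s W (U n) (f W x)" if "n \<ge> 1" for n
      using presheaf_morphism_natural[OF f W U(1) U_le] that \<open>x \<in> carrier (M W)\<close> by blast
    then show ?thesis by auto
  qed
  then have "bij_betw (?\<Psi> \<circ> f W) (carrier (M W)) (\<Pi>\<^sub>E n\<in>{1..}. carrier (N (U n)))"
    using bij_betw_trans[OF bM bG] by (subst (asm) bij_betw_cong) auto
  moreover have "f W ` carrier (M W) \<subseteq> carrier (N W)" using mod_homD(1)[OF fW] by blast
  ultimately have "bij_betw (f W) (carrier (M W)) (carrier (N W))"
    using bij_betw_comp_iff2[OF bN] by blast
  then show ?thesis using fW unfolding mod_iso_def W_def by blast
qed

text \<open>The square with reversed arrows,
  \<open>f W \<circ> ?\<Phi> = ?\<Psi> \<circ> ?G\<close>. Two points are new: \<open>?G\<close> has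
  to respect finite support, and \<open>f W\<close> has to commute with the sum defining
  \<open>?\<Phi>\<close>.\<close>

lemma precosheaf_morphism_iso_Union:
  assumes M: "cds_precosheaf R X M e" and N: "cds_precosheaf R X N d"
    and f: "precosheaf_morphism R X M e N d f"
    and U: "\<And>n::nat. n \<ge> 1 \<Longrightarrow> openin X (U n)" "disjoint_family_on U {1..}"
    and iso: "\<And>n. n \<ge> 1 \<Longrightarrow> f (U n) \<in> mod_iso R (M (U n)) (N (U n))"
  shows "f (\<Union>n\<in>{1..}. U n) \<in> mod_iso R (M (\<Union>n\<in>{1..}. U n)) (N (\<Union>n\<in>{1..}. U n))"
proof -
  define W where "W = (\<Union>n\<in>{1..}. U n)"
  let ?\<Phi> = "mod_sum_map {1..} (\<lambda>n. M (U n)) (M W) (\<lambda>n. e (U n) W)"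
  let ?\<Psi> = "mod_sum_map {1..} (\<lambda>n. N (U n)) (N W) (\<lambda>n. d (U n) W)"
  let ?G = "\<lambda>x. \<lambda>n\<in>{1..}. f (U n) (x n)"
  let ?DM = "carrier (mod_dsum {1..} (\<lambda>n. M (U n)))" and ?DN = "carrier (mod_dsum {1..} (\<lambda>n. N (U n)))"
  have W: "openin X W" unfolding W_def using U(1) by auto
  have U_le: "U n \<subseteq> W" if "n \<ge> 1" for n unfolding W_def using that by auto
  have pM: "precosheaf R X M e" and pN: "precosheaf R X N d"
    using M N unfolding cds_precosheaf_def by auto
  have fW: "f W \<in> mod_hom R (M W) (N W)" using f W by (rule precosheaf_morphism_mod_hom)
  interpret fW: abelian_group_hom "M W" "N W" "f W"
    by (rule mod_hom_abelian_group_hom[OF precosheaf_abelian_group[OF pM W] precosheaf_abelian_group[OF pN W] fW])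
  have bM: "bij_betw ?\<Phi> ?DM (carrier (M W))"
    using M U unfolding cds_precosheaf_def mod_iso_def W_def by auto
  have bN: "bij_betw ?\<Psi> ?DN (carrier (N W))"
    using N U unfolding cds_precosheaf_def mod_iso_def W_def by auto
  have bU: "bij_betw (f (U n)) (carrier (M (U n))) (carrier (N (U n)))" if "n \<ge> 1" for n
    using iso[OF that] unfolding mod_iso_def by blast
  \<comment> \<open>This makes the supports of \<open>x\<close> and \<open>?G x\<close> equal, so
    that later both sums run over the same index set \<open>?S\<close>.\<close>
  have zero_iff: "f (U n) a = \<zero>\<^bsub>N (U n)\<^esub> \<longleftrightarrow> a = \<zero>\<^bsub>M (U n)\<^esub>" if n: "n \<ge> 1" and a: "a \<in> carrier (M (U n))" for n a
  proof -
    interpret abelian_group_hom "M (U n)" "N (U n)" "f (U n)"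
      using iso[OF n] precosheaf_abelian_group[OF pM U(1)[OF n]] precosheaf_abelian_group[OF pN U(1)[OF n]]
      unfolding mod_iso_def by (intro mod_hom_abelian_group_hom) auto
    show ?thesis
      using bU[OF n] a hom_zero by (metis G.zero_closed bij_betw_imp_inj_on inj_onD)
  qed
  have supp: "{n \<in> {1..}. ?G x n \<noteq> \<zero>\<^bsub>N (U n)\<^esub>} = {n \<in> {1..}. x n \<noteq> \<zero>\<^bsub>M (U n)\<^esub>}"
    if "x \<in> (\<Pi>\<^sub>E n\<in>{1..}. carrier (M (U n)))" for x
    using that zero_iff by (auto simp: PiE_iff)
  have "bij_betw ?G (\<Pi>\<^sub>E n\<in>{1..}. carrier (M (U n))) (\<Pi>\<^sub>E n\<in>{1..}. carrier (N (U n)))"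
    using bU by (intro bij_betw_PiE) auto
  then have bG: "bij_betw ?G ?DM ?DN"
    using supp unfolding mod_dsum_def by (simp del: restrict_apply) (rule bij_betw_Collect; simp del: restrict_apply)
  have "(?\<Psi> \<circ> ?G) x = (f W \<circ> ?\<Phi>) x" if "x \<in> ?DM" for x
  proof -
    have x: "x \<in> (\<Pi>\<^sub>E n\<in>{1..}. carrier (M (U n)))"
      using that unfolding mod_dsum_def by simp
    let ?S = "{n \<in> {1..}. x n \<noteq> \<zero>\<^bsub>M (U n)\<^esub>}"
    have eU: "e (U n) W (x n) \<in> carrier (M W)"
      and comm: "f W (e (U n) W (x n)) = d (U n) W (f (U n) (x n))"
      and dU: "d (U n) W (f (U n) (x n)) \<in> carrier (N W)" if n: "n \<in> ?S" for n
    proof -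
      have n: "n \<ge> 1" "U n \<subseteq> W" "x n \<in> carrier (M (U n))" using n x U_le by auto
      have "e (U n) W \<in> mod_hom R (M (U n)) (M W)"
        using precosheaf_mod_hom[OF pM W U(1)[OF n(1)] n(2)] .
      then show "e (U n) W (x n) \<in> carrier (M W)" using n(3) by (rule mod_homD(1))
      show "f W (e (U n) W (x n)) = d (U n) W (f (U n) (x n))"
        using precosheaf_morphism_natural[OF f W U(1)[OF n(1)] n(2,3)] .
      then show "d (U n) W (f (U n) (x n)) \<in> carrier (N W)"
        using \<open>e (U n) W (x n) \<in> carrier (M W)\<close> fW.hom_closed by metis
    qed
    have "f W (?\<Phi> x) = (\<Oplus>\<^bsub>N W\<^esub>n\<in>?S. f W (e (U n) W (x n)))"
      unfolding mod_sum_map_def using eU by (intro fW.hom_finsum) blast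
    also have "\<dots> = (\<Oplus>\<^bsub>N W\<^esub>n\<in>?S. d (U n) W (?G x n))"
      using comm dU by (intro fW.H.finsum_cong') auto
    also have "\<dots> = ?\<Psi> (?G x)"
      unfolding mod_sum_map_def supp[OF x] ..
    finally show ?thesis by simp
  qed
  then have "bij_betw (f W \<circ> ?\<Phi>) ?DM (carrier (N W))"
    using bij_betw_trans[OF bG bN] by (subst (asm) bij_betw_cong) auto
  then have "bij_betw (f W) (carrier (M W)) (carrier (N W))"
    using bij_betw_comp_iff[OF bM] by blast
  then show ?thesis using fW unfolding mod_iso_def W_def by blast
qed

section \<open>Mayer-Vietoris systems\<close>

text \<open>The five lemma applies to the stretch centred at \<open>U \<union> V\<close> in degree
  \<open>p\<close>: before it come the pair \<open>U\<close>, \<open>V\<close> and then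
  \<open>U \<inter> V\<close> in degree \<open>p - 1\<close>, after it the pair and then
  \<open>U \<inter> V\<close> in degree \<open>p\<close>. The assumed isomorphisms hold in all
  degrees, so they cover both.\<close>

lemma mv_iso_at_Un_presheaves:
  assumes M: "mv_system_presheaves R X M" and N: "mv_system_presheaves R X N"
    and F: "mv_morphism_presheaves R X M N F"
    and U: "openin X U" and V: "openin X V"
    and iso: "mv_iso_at R M N F U" "mv_iso_at R M N F V" "mv_iso_at R M N F (U \<inter> V)"
  shows "mv_iso_at R M N F (U \<union> V)"
  unfolding mv_iso_at_def
proof
  fix p
  have UV: "openin X (U \<inter> V)" "openin X (U \<union> V)" using U V by auto
  have pM: "presheaf R X (obj M p) (arr M p)" and pN: "presheaf R X (obj N p) (arr N p)" for p
    using M N unfolding mv_system_presheaves_def by auto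
  have hom: "F p W \<in> mod_hom R (obj M p W) (obj N p W)" if "openin X W" for p W
    using F[unfolded mv_morphism_presheaves_def, THEN conjunct1] presheaf_morphism_mod_hom that by blast
  have grp: "abelian_group (obj M p W)" "abelian_group (obj N p W)" if "openin X W" for p W
    using presheaf_abelian_group[OF pM that] presheaf_abelian_group[OF pN that] .
  have ghom: "abelian_group_hom (obj M p W) (obj N p W) (F p W)" if "openin X W" for p W
    using mod_hom_abelian_group_hom[OF grp hom] that by blast
  have bij: "bij_betw (F p W) (carrier (obj M p W)) (carrier (obj N p W))" if "mv_iso_at R M N F W" for p W
    using that unfolding mv_iso_at_def mod_iso_def by blast
  note bij = bij[OF iso(1)] bij[OF iso(2)] bij[OF iso(3)]
  note bij_sum = bij_betw_mod_sum2[OF bij(1,2)]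
  note ex = M[unfolded mv_system_presheaves_def, THEN conjunct2, rule_format, OF U V]
    N[unfolded mv_system_presheaves_def, THEN conjunct2, rule_format, OF U V]
  note comm = F[unfolded mv_morphism_presheaves_def, THEN conjunct2, rule_format, OF U V, THEN conjunct1, rule_format]
    F[unfolded mv_morphism_presheaves_def, THEN conjunct2, rule_format, OF U V, THEN conjunct2, THEN conjunct1, rule_format]
    F[unfolded mv_morphism_presheaves_def, THEN conjunct2, rule_format, OF U V, THEN conjunct2, THEN conjunct2, rule_format]
  have "bij_betw (F p (U \<union> V)) (carrier (obj M p (U \<union> V))) (carrier (obj N p (U \<union> V)))"
  proof (rule five_lemma)
    \<comment> \<open>The third exactness clause at \<open>p - 1\<close>, where the target degree
      \<open>p - 1 + 1\<close> simplifies to \<open>p\<close>.\<close>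
    show "mod_exact (mod_sum2 (obj M (p - 1) U) (obj M (p - 1) V)) (presheaf_Q M (p - 1) U V)
        (obj M (p - 1) (U \<inter> V)) (conn M (p - 1) U V) (obj M p (U \<union> V))"
      using ex(1)[of "p - 1"] by simp
    show "mod_exact (mod_sum2 (obj N (p - 1) U) (obj N (p - 1) V)) (presheaf_Q N (p - 1) U V)
        (obj N (p - 1) (U \<inter> V)) (conn N (p - 1) U V) (obj N p (U \<union> V))"
      using ex(2)[of "p - 1"] by simp
    show "mod_exact (obj M (p - 1) (U \<inter> V)) (conn M (p - 1) U V)
        (obj M p (U \<union> V)) (presheaf_P M p U V) (mod_sum2 (obj M p U) (obj M p V))"
      and "mod_exact (obj M p (U \<union> V)) (presheaf_P M p U V)
        (mod_sum2 (obj M p U) (obj M p V)) (presheaf_Q M p U V) (obj M p (U \<inter> V))"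
      using ex(1) by blast+
    show "mod_exact (obj N (p - 1) (U \<inter> V)) (conn N (p - 1) U V)
        (obj N p (U \<union> V)) (presheaf_P N p U V) (mod_sum2 (obj N p U) (obj N p V))"
      and "mod_exact (obj N p (U \<union> V)) (presheaf_P N p U V)
        (mod_sum2 (obj N p U) (obj N p V)) (presheaf_Q N p U V) (obj N p (U \<inter> V))"
      using ex(2) by blast+
    show "presheaf_Q M p U V x \<in> carrier (obj M p (U \<inter> V))"
      if "x \<in> carrier (mod_sum2 (obj M p U) (obj M p V))" for x
      using mod_exactD(1)[of _ "presheaf_Q M p U V"] ex(1) that by blast
    show "abelian_group_hom (obj N p (U \<union> V)) (mod_sum2 (obj N p U) (obj N p V)) (presheaf_P N p U V)"
    proof (rule abelian_group_homI_add)
      have "arr N p (U \<union> V) U \<in> mod_hom R (obj N p (U \<union> V)) (obj N p U)"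
        "arr N p (U \<union> V) V \<in> mod_hom R (obj N p (U \<union> V)) (obj N p V)"
        using U V UV by (auto intro: presheaf_mod_hom[OF pN])
      note h = mod_homD[OF this(1)] mod_homD[OF this(2)]
      show "presheaf_P N p U V x \<in> carrier (mod_sum2 (obj N p U) (obj N p V))"
        if "x \<in> carrier (obj N p (U \<union> V))" for x
        using h that by (simp add: presheaf_P_def mod_sum2_def)
      show "presheaf_P N p U V (x \<oplus>\<^bsub>obj N p (U \<union> V)\<^esub> y) =
          presheaf_P N p U V x \<oplus>\<^bsub>mod_sum2 (obj N p U) (obj N p V)\<^esub> presheaf_P N p U V y"
        if "x \<in> carrier (obj N p (U \<union> V))" "y \<in> carrier (obj N p (U \<union> V))" for x y
        using h that by (simp add: presheaf_P_def mod_sum2_def)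
    qed (simp_all add: grp U V UV abelian_group_mod_sum2)
    show "abelian_group_hom (mod_sum2 (obj M p U) (obj M p V)) (mod_sum2 (obj N p U) (obj N p V))
        (map_prod (F p U) (F p V))"
      by (intro mod_sum2_hom ghom U V)
    show "F p (U \<union> V) (conn M (p - 1) U V x) = conn N (p - 1) U V (F (p - 1) (U \<inter> V) x)"
      if "x \<in> carrier (obj M (p - 1) (U \<inter> V))" for x
      using comm(3)[of x "p - 1"] that by simp
    show "map_prod (F (p - 1) U) (F (p - 1) V) ` carrier (mod_sum2 (obj M (p - 1) U) (obj M (p - 1) V))
        = carrier (mod_sum2 (obj N (p - 1) U) (obj N (p - 1) V))"
      by (rule bij_betw_imp_surj_on[OF bij_sum])
    show "inj_on (F p (U \<inter> V)) (carrier (obj M p (U \<inter> V)))"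
      by (rule bij_betw_imp_inj_on[OF bij(3)])
  qed (simp_all add: comm ghom UV bij bij_sum)
  then show "F p (U \<union> V) \<in> mod_iso R (obj M p (U \<union> V)) (obj N p (U \<union> V))"
    using hom[OF UV(2)] unfolding mod_iso_def by blast
qed

text \<open>Variance moves the stretch: before \<open>U \<union> V\<close> in degree
  \<open>p\<close> come \<open>U \<inter> V\<close> and the pair \<open>U\<close>, \<open>V\<close>
  in the same degree, after it \<open>U \<inter> V\<close> and the pair in degree
  \<open>p + 1\<close>. The middle map out is now the connecting map.\<close>

lemma mv_iso_at_Un_precosheaves:
  assumes M: "mv_system_precosheaves R X M" and N: "mv_system_precosheaves R X N"
    and F: "mv_morphism_precosheaves R X M N F"
    and U: "openin X U" and V: "openin X V"
    and iso: "mv_iso_at R M N F U" "mv_iso_at R M N F V" "mv_iso_at R M N F (U \<inter> V)"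
  shows "mv_iso_at R M N F (U \<union> V)"
  unfolding mv_iso_at_def
proof
  fix p
  have UV: "openin X (U \<inter> V)" "openin X (U \<union> V)" using U V by auto
  have pM: "precosheaf R X (obj M p) (arr M p)" and pN: "precosheaf R X (obj N p) (arr N p)" for p
    using M N unfolding mv_system_precosheaves_def by auto
  have hom: "F p W \<in> mod_hom R (obj M p W) (obj N p W)" if "openin X W" for p W
    using F[unfolded mv_morphism_precosheaves_def, THEN conjunct1] precosheaf_morphism_mod_hom that by blast
  have grp: "abelian_group (obj M p W)" "abelian_group (obj N p W)" if "openin X W" for p W
    using precosheaf_abelian_group[OF pM that] precosheaf_abelian_group[OF pN that] .
  have ghom: "abelian_group_hom (obj M p W) (obj N p W) (F p W)" if "openin X W" for p W
    using mod_hom_abelian_group_hom[OF grp hom] that by blast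
  have bij: "bij_betw (F p W) (carrier (obj M p W)) (carrier (obj N p W))" if "mv_iso_at R M N F W" for p W
    using that unfolding mv_iso_at_def mod_iso_def by blast
  note bij = bij[OF iso(1)] bij[OF iso(2)] bij[OF iso(3)]
  note bij_sum = bij_betw_mod_sum2[OF bij(1,2)]
  note ex = M[unfolded mv_system_precosheaves_def, THEN conjunct2, rule_format, OF U V]
    N[unfolded mv_system_precosheaves_def, THEN conjunct2, rule_format, OF U V]
  note comm = F[unfolded mv_morphism_precosheaves_def, THEN conjunct2, rule_format, OF U V, THEN conjunct1, rule_format]
    F[unfolded mv_morphism_precosheaves_def, THEN conjunct2, rule_format, OF U V, THEN conjunct2, THEN conjunct1, rule_format]
    F[unfolded mv_morphism_precosheaves_def, THEN conjunct2, rule_format, OF U V, THEN conjunct2, THEN conjunct2, rule_format]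
  have "bij_betw (F p (U \<union> V)) (carrier (obj M p (U \<union> V))) (carrier (obj N p (U \<union> V)))"
  proof (rule five_lemma)
    show "mod_exact (obj M p (U \<inter> V)) (precosheaf_P M p U V)
        (mod_sum2 (obj M p U) (obj M p V)) (precosheaf_Q M p U V) (obj M p (U \<union> V))"
      and "mod_exact (mod_sum2 (obj M p U) (obj M p V)) (precosheaf_Q M p U V)
        (obj M p (U \<union> V)) (conn M p U V) (obj M (p + 1) (U \<inter> V))"
      using ex(1) by blast+
    show ex_M: "mod_exact (obj M p (U \<union> V)) (conn M p U V)
        (obj M (p + 1) (U \<inter> V)) (precosheaf_P M (p + 1) U V)
        (mod_sum2 (obj M (p + 1) U) (obj M (p + 1) V))"
      using ex(1)[of "p + 1"] by simp
    show "mod_exact (obj N p (U \<inter> V)) (precosheaf_P N p U V)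
        (mod_sum2 (obj N p U) (obj N p V)) (precosheaf_Q N p U V) (obj N p (U \<union> V))"
      and "mod_exact (mod_sum2 (obj N p U) (obj N p V)) (precosheaf_Q N p U V)
        (obj N p (U \<union> V)) (conn N p U V) (obj N (p + 1) (U \<inter> V))"
      using ex(2) by blast+
    show "mod_exact (obj N p (U \<union> V)) (conn N p U V)
        (obj N (p + 1) (U \<inter> V)) (precosheaf_P N (p + 1) U V)
        (mod_sum2 (obj N (p + 1) U) (obj N (p + 1) V))"
      using ex(2)[of "p + 1"] by simp
    show "precosheaf_P M (p + 1) U V x \<in> carrier (mod_sum2 (obj M (p + 1) U) (obj M (p + 1) V))"
      if "x \<in> carrier (obj M (p + 1) (U \<inter> V))" for x
      using mod_exactD(1)[of _ "precosheaf_P M (p + 1) U V"] ex(1) that by blast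
    show "abelian_group_hom (obj N p (U \<union> V)) (obj N (p + 1) (U \<inter> V)) (conn N p U V)"
      using ex(2) UV by (intro mod_hom_abelian_group_hom[OF grp(2) grp(2)]) auto
    show "abelian_group_hom (mod_sum2 (obj M (p + 1) U) (obj M (p + 1) V))
        (mod_sum2 (obj N (p + 1) U) (obj N (p + 1) V)) (map_prod (F (p + 1) U) (F (p + 1) V))"
      by (intro mod_sum2_hom ghom U V)
    show "map_prod (F p U) (F p V) (precosheaf_P M p U V x) = precosheaf_P N p U V (F p (U \<inter> V) x)"
      if "x \<in> carrier (obj M p (U \<inter> V))" for x
      using that by (rule comm(1))
    show "F (p + 1) (U \<inter> V) (conn M p U V x) = conn N p U V (F p (U \<union> V) x)"
      if "x \<in> carrier (obj M p (U \<union> V))" for x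
      using that by (rule comm(3))
    show "F p (U \<inter> V) ` carrier (obj M p (U \<inter> V)) = carrier (obj N p (U \<inter> V))"
      by (rule bij_betw_imp_surj_on[OF bij(3)])
    show "inj_on (map_prod (F (p + 1) U) (F (p + 1) V)) (carrier (mod_sum2 (obj M (p + 1) U) (obj M (p + 1) V)))"
      by (rule bij_betw_imp_inj_on[OF bij_sum])
  qed (simp_all add: comm ghom UV bij bij_sum)
  then show "F p (U \<union> V) \<in> mod_iso R (obj M p (U \<union> V)) (obj N p (U \<union> V))"
    using hom[OF UV(2)] unfolding mod_iso_def by blast
qed

section \<open>Disjoint unions and the empty set, degree by degree\<close>

lemma mv_iso_at_Union_presheaves:
  assumes M: "mv_system_cdp_presheaves R X M" and N: "mv_system_cdp_presheaves R X N"
    and F: "mv_morphism_presheaves R X M N F"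
    and U: "\<And>n::nat. n \<ge> 1 \<Longrightarrow> openin X (U n)" "disjoint_family_on U {1..}"
    and iso: "\<And>n. n \<ge> 1 \<Longrightarrow> mv_iso_at R M N F (U n)"
  shows "mv_iso_at R M N F (\<Union>n\<in>{1..}. U n)"
  unfolding mv_iso_at_def
proof
  fix p
  show "F p (\<Union>n\<in>{1..}. U n) \<in> mod_iso R (obj M p (\<Union>n\<in>{1..}. U n)) (obj N p (\<Union>n\<in>{1..}. U n))"
  proof (rule presheaf_morphism_iso_Union)
    show "cdp_presheaf R X (obj M p) (arr M p)" "cdp_presheaf R X (obj N p) (arr N p)"
      using M N unfolding mv_system_cdp_presheaves_def by blast+
    show "presheaf_morphism R X (obj M p) (arr M p) (obj N p) (arr N p) (F p)"
      using F[unfolded mv_morphism_presheaves_def, THEN conjunct1, THEN spec] .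
    show "F p (U n) \<in> mod_iso R (obj M p (U n)) (obj N p (U n))" if "n \<ge> 1" for n
      using iso[OF that] unfolding mv_iso_at_def by blast
    show "openin X (U n)" if "n \<ge> 1" for n using that by (rule U(1))
    show "disjoint_family_on U {1..}" by (rule U(2))
  qed
qed

lemma mv_iso_at_Union_precosheaves:
  assumes M: "mv_system_cds_precosheaves R X M" and N: "mv_system_cds_precosheaves R X N"
    and F: "mv_morphism_precosheaves R X M N F"
    and U: "\<And>n::nat. n \<ge> 1 \<Longrightarrow> openin X (U n)" "disjoint_family_on U {1..}"
    and iso: "\<And>n. n \<ge> 1 \<Longrightarrow> mv_iso_at R M N F (U n)"
  shows "mv_iso_at R M N F (\<Union>n\<in>{1..}. U n)"
  unfolding mv_iso_at_def
proof
  fix p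
  show "F p (\<Union>n\<in>{1..}. U n) \<in> mod_iso R (obj M p (\<Union>n\<in>{1..}. U n)) (obj N p (\<Union>n\<in>{1..}. U n))"
  proof (rule precosheaf_morphism_iso_Union)
    show "cds_precosheaf R X (obj M p) (arr M p)" "cds_precosheaf R X (obj N p) (arr N p)"
      using M N unfolding mv_system_cds_precosheaves_def by blast+
    show "precosheaf_morphism R X (obj M p) (arr M p) (obj N p) (arr N p) (F p)"
      using F[unfolded mv_morphism_precosheaves_def, THEN conjunct1, THEN spec] .
    show "F p (U n) \<in> mod_iso R (obj M p (U n)) (obj N p (U n))" if "n \<ge> 1" for n
      using iso[OF that] unfolding mv_iso_at_def by blast
    show "openin X (U n)" if "n \<ge> 1" for n using that by (rule U(1))
    show "disjoint_family_on U {1..}" by (rule U(2))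
  qed
qed

lemma mv_iso_at_empty_presheaves:
  assumes M: "mv_system_cdp_presheaves R X M" and N: "mv_system_cdp_presheaves R X N"
    and F: "mv_morphism_presheaves R X M N F"
  shows "mv_iso_at R M N F {}"
  unfolding mv_iso_at_def
proof
  fix p
  have cM: "cdp_presheaf R X (obj M p) (arr M p)" and cN: "cdp_presheaf R X (obj N p) (arr N p)"
    using M N unfolding mv_system_cdp_presheaves_def by blast+
  show "F p {} \<in> mod_iso R (obj M p {}) (obj N p {})"
  proof (rule mod_iso_zero)
    show "abelian_group (obj M p {})" "abelian_group (obj N p {})"
      using presheaf_abelian_group[OF cM[unfolded cdp_presheaf_def, THEN conjunct1] openin_empty]
        presheaf_abelian_group[OF cN[unfolded cdp_presheaf_def, THEN conjunct1] openin_empty] .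
    show "F p {} \<in> mod_hom R (obj M p {}) (obj N p {})"
      using F[unfolded mv_morphism_presheaves_def, THEN conjunct1, THEN spec] openin_empty
      by (rule presheaf_morphism_mod_hom)
    show "carrier (obj M p {}) \<subseteq> {\<zero>\<^bsub>obj M p {}\<^esub>}"
      using cdp_presheaf_empty[OF cM] by (intro subsetI) (simp only: singleton_iff)
    show "carrier (obj N p {}) \<subseteq> {\<zero>\<^bsub>obj N p {}\<^esub>}"
      using cdp_presheaf_empty[OF cN] by (intro subsetI) (simp only: singleton_iff)
  qed
qed

lemma mv_iso_at_empty_precosheaves:
  assumes M: "mv_system_cds_precosheaves R X M" and N: "mv_system_cds_precosheaves R X N"
    and F: "mv_morphism_precosheaves R X M N F"
  shows "mv_iso_at R M N F {}"
  unfolding mv_iso_at_def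
proof
  fix p
  have cM: "cds_precosheaf R X (obj M p) (arr M p)" and cN: "cds_precosheaf R X (obj N p) (arr N p)"
    using M N unfolding mv_system_cds_precosheaves_def by blast+
  show "F p {} \<in> mod_iso R (obj M p {}) (obj N p {})"
  proof (rule mod_iso_zero)
    show "abelian_group (obj M p {})" "abelian_group (obj N p {})"
      using precosheaf_abelian_group[OF cM[unfolded cds_precosheaf_def, THEN conjunct1] openin_empty]
        precosheaf_abelian_group[OF cN[unfolded cds_precosheaf_def, THEN conjunct1] openin_empty] .
    show "F p {} \<in> mod_hom R (obj M p {}) (obj N p {})"
      using F[unfolded mv_morphism_precosheaves_def, THEN conjunct1, THEN spec] openin_empty
      by (rule precosheaf_morphism_mod_hom)
    show "carrier (obj M p {}) \<subseteq> {\<zero>\<^bsub>obj M p {}\<^esub>}"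
      using cds_precosheaf_empty[OF cM] by (intro subsetI) (simp only: singleton_iff)
    show "carrier (obj N p {}) \<subseteq> {\<zero>\<^bsub>obj N p {}\<^esub>}"
      using cds_precosheaf_empty[OF cN] by (intro subsetI) (simp only: singleton_iff)
  qed
qed

section \<open>Combining the closure properties with the induction on open sets\<close>

theorem theorem1p1:
  fixes R :: "('r, 's) ring_scheme"
    and X :: "'x topology"
    and \<A> :: "('x set \<times> ('x \<Rightarrow> nat \<Rightarrow> real)) set"
    and n :: nat
    and M :: "('x, 'r, 'm) mv_data"
    and N :: "('x, 'r, 'n) mv_data"
    and F :: "int \<Rightarrow> 'x set \<Rightarrow> 'm \<Rightarrow> 'n"
  assumes "cring R"
    and "smooth_manifold n X \<A>"
    and "connected_space X"
    and "(mv_system_cdp_presheaves R X M \<and> mv_system_cdp_presheaves R X N \<and>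
            mv_morphism_presheaves R X M N F) \<or>
         (mv_system_cds_precosheaves R X M \<and> mv_system_cds_precosheaves R X N \<and>
            mv_morphism_precosheaves R X M N F)"
    and "\<exists>\<UU>. topology_basis X \<UU> \<and>
           (\<forall>\<V>. finite \<V> \<and> \<V> \<noteq> {} \<and> \<V> \<subseteq> \<UU> \<longrightarrow> mv_iso_at R M N F (\<Inter>\<V>))"
  shows "mv_iso R X M N F"
proof -
  obtain \<UU> where basis: "topology_basis X \<UU>"
    and inter: "\<And>\<V>. finite \<V> \<Longrightarrow> \<V> \<noteq> {} \<Longrightarrow> \<V> \<subseteq> \<UU> \<Longrightarrow> mv_iso_at R M N F (\<Inter>\<V>)"
    using assms(5) by blast
  have X: "Hausdorff_space X" "locally_compact_space X" "second_countable X"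
    using assms(2) locally_compact_space_manifold[OF assms(2)] by (simp_all add: smooth_manifold_def)
  \<comment> \<open>Both variances yield the same closure properties, so the case distinction is
    confined to these three facts.\<close>
  have empty: "mv_iso_at R M N F {}"
    using assms(4) by (elim disjE conjE) (rule mv_iso_at_empty_presheaves mv_iso_at_empty_precosheaves; assumption)+
  have union: "mv_iso_at R M N F (U \<union> V)"
    if "openin X U" "openin X V" "mv_iso_at R M N F U" "mv_iso_at R M N F V" "mv_iso_at R M N F (U \<inter> V)"
    for U V
    using assms(4) unfolding mv_system_cdp_presheaves_def mv_system_cds_precosheaves_def
    by (elim disjE conjE) (rule mv_iso_at_Un_presheaves[OF _ _ _ that] mv_iso_at_Un_precosheaves[OF _ _ _ that]; assumption)+
  have disjoint: "mv_iso_at R M N F (\<Union>n. U n)"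
    if U: "\<And>n. openin X (U n)" "disjoint_family U" "\<And>n. mv_iso_at R M N F (U n)" for U :: "nat \<Rightarrow> 'x set"
  proof -
    \<comment> \<open>The cdp and cds conditions count from 1 and the induction from 0, hence the
      shift. Truncated subtraction causes no collision because all indices are at least 1.\<close>
    let ?U = "\<lambda>n. U (n - 1)"
    have d: "disjoint_family_on ?U {1..}"
      unfolding disjoint_family_on_def
    proof (intro ballI impI)
      fix m n :: nat assume "m \<in> {1..}" "n \<in> {1..}" "m \<noteq> n"
      then have "m - 1 \<noteq> n - 1" by simp
      then show "?U m \<inter> ?U n = {}" by (rule disjoint_family_onD[OF U(2) UNIV_I UNIV_I])
    qed
    have "mv_iso_at R M N F (\<Union>n\<in>{1..}. ?U n)"
      using assms(4)
      by (elim disjE conjE)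
        (rule mv_iso_at_Union_presheaves[where U = ?U, OF _ _ _ U(1) d U(3)]
          mv_iso_at_Union_precosheaves[where U = ?U, OF _ _ _ U(1) d U(3)]; assumption)+
    moreover have "(\<Union>n\<in>{1..}. ?U n) = (\<Union>n. U n)"
    proof -
      have "n \<in> (\<lambda>n. n - 1) ` {1..}" for n :: nat
        by (rule image_eqI[of _ _ "Suc n"]) simp_all
      then have "(\<lambda>n. n - 1) ` {1..} = (UNIV :: nat set)" by blast
      then show ?thesis using image_image[of U "\<lambda>n. n - 1" "{1..}"] by simp
    qed
    ultimately show ?thesis by simp
  qed
  show ?thesis
    unfolding mv_iso_def
  proof (intro allI impI)
    fix U assume U: "openin X U"
    show "mv_iso_at R M N F U"
    proof (rule openin_basis_induct[where P = "mv_iso_at R M N F", OF X basis _ empty _ _ U])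
      show "mv_iso_at R M N F (\<Inter>\<V>)" if "finite \<V>" "\<V> \<noteq> {}" "\<V> \<subseteq> \<UU>" for \<V>
        using that by (rule inter)
      show "mv_iso_at R M N F (V \<union> W)"
        if "openin X V" "openin X W" "mv_iso_at R M N F V" "mv_iso_at R M N F W" "mv_iso_at R M N F (V \<inter> W)"
        for V W
        using that by (rule union)
      show "mv_iso_at R M N F (\<Union>n. V n)"
        if "\<And>n. openin X (V n)" "disjoint_family V" "\<And>n. mv_iso_at R M N F (V n)" for V :: "nat \<Rightarrow> 'x set"
        using that by (rule disjoint)
    qed
  qed
qed

end
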